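(* Let $T\colon\ell_1\to\ell_1$ be C. J. Read's operator associated with a sequence $\mathbf d=(a_1,b_1,a_2,b_2,\ldots)$. Provided $\mathbf d$ increases sufficiently rapidly, the following hold: (1) each of $|T|$, $T^+$ and $T^-$ has a positive eigenvector; (2) neither $|T|$ nor $T^+$ has an invariant ideal.
   Context: Construction of Read's operator $T$. Let $(f_i)_{i=0}^\infty$ be the standard unit vectors of $\ell_1$ and let $F$ be their linear span. Let $\mathbf d=(a_1,b_1,a_2,b_2,\ldots)$ be a strictly increasing sequence of positive integers. Put $a_0=1$, $v_0=0$ and $v_n=n(a_n+b_n)$ for $n\ge1$. For $\mathbf d$ increasing sufficiently rapidly there is a unique sequence $(e_i)_{i=0}^\infty\subset F$ with the following properties (with the convention $0^0=1$): 0) $f_0=e_0$; A) if integers $r,n,i$ satisfy $0<r\le n$ and $i\in[0,v_{n-r}]+ra_n$, then $f_i=(n^{ra_n}e_i-e_{i-ra_n})(n-r)^{i-ra_n}a_{n-r}$; B) if integers $r,n,i$ satisfy $0<r<n$ and $i\in(ra_n+v_{n-r},(r+1)a_n)$ (respectively, $1\le n$ and $i\in(v_{n-1},a_n)$), then $f_i=n^i2^{(h-i)/\sqrt{a_n}}e_i$, where $h=(r+\frac12)a_n$ (respectively, $h=\frac12a_n$); C) if integers $r,n,i$ satisfy $0<r\le n$ and $i\in[r(a_n+b_n),na_n+rb_n]$, then $f_i=n^ie_i-b_nn^{i-b_n}e_{i-b_n}$; D) if integers $r,n,i$ satisfy $0\le r<n$ and $i\in(na_n+rb_n,(r+1)(a_n+b_n))$,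 then $f_i=n^i2^{(h-i)/\sqrt{b_n}}e_i$, where $h=(r+\frac12)b_n$. The vectors $e_i$ are linearly independent and span $F$. Let $T\colon F\to F$ be the unique linear map with $Te_i=e_{i+1}$ for all $i\ge0$. Read proved that, provided $\mathbf d$ increases sufficiently rapidly, $\|Tf_i\|\le1$ for every $i\ge0$, so $T$ extends uniquely to a bounded operator on $\ell_1$, also denoted $T$, and that this $T$ is quasinilpotent and has no closed invariant subspaces other than $\{0\}$ and $\ell_1$. "A property holds provided $\mathbf d$ increases sufficiently rapidly" means: there exist positive integer-valued functions $G,H$ such that the property holds for every strictly increasing $\mathbf d$ satisfying, for all $n\ge1$, $a_n\ge G(n,a_0,a_1,b_1,\ldots,a_{n-1},b_{n-1})$ and $b_n\ge H(n,a_0,a_1,b_1,\ldots,a_{n-1},b_{n-1},a_n)$. Every operator $S$ on $\ell_1$ is identified with its matrix $(s_{ij})_{i,j\ge0}$, $s_{ij}=(Sf_j)_i$. Every bounded operator on $\ell_1$ has a modulus; for an operator $S$ with real matrix (such as $T$), $|S|$, $S^+$, $S^-$ have matrices $(|s_{ij}|)$, $(\max(s_{ij},0))$, $(\max(-s_{ij},0))$, so that $S=S^+-S^-$ and $|S|=S^++S^-$. $\ell_1$ carries its coordinatewise Banach lattice order. A positive eigenvector is an eigenvector that is a (non-zero) positive vector. An invariant ideal of an operator on $\ell_1$ is a closed lattice (order) ideal, different from $\{0\}$ and from $\ell_1$, that is mapped into itself by the operator. *)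

theory Defs
  imports "HOL-Analysis.Analysis" "HOL-Library.Lattice_Algebras"
begin

section \<open>The Banach lattice of absolutely summable real sequences\<close>

typedef ell1 = "{x :: nat \<Rightarrow> real. summable (\<lambda>i. \<bar>x i\<bar>)}"
  morphisms coord Abs_ell1
  by (rule exI[of _ "\<lambda>_. 0"]) simp

setup_lifting type_definition_ell1

lemma summable_abs_dominated:
  fixes x y z :: "nat \<Rightarrow> real"
  assumes "summable (\<lambda>i. \<bar>x i\<bar>)" "summable (\<lambda>i. \<bar>y i\<bar>)"
    and "\<And>i. \<bar>z i\<bar> \<le> \<bar>x i\<bar> + \<bar>y i\<bar>"
  shows "summable (\<lambda>i. \<bar>z i\<bar>)"
  by (rule summable_comparison_test'[OF summable_add[OF assms(1,2)], of 0]) (use assms(3) in auto)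

lemma summable_coord: "summable (\<lambda>i. \<bar>coord x i\<bar>)"
  using coord[of x] by simp

lemma ell1_eqI: "(\<And>i. coord x i = coord y i) \<Longrightarrow> x = y"
  by (metis coord_inject ext)

instantiation ell1 :: real_vector
begin

lift_definition zero_ell1 :: ell1 is "\<lambda>_. 0" by simp

lift_definition plus_ell1 :: "ell1 \<Rightarrow> ell1 \<Rightarrow> ell1" is "\<lambda>x y i. x i + y i"
  by (erule (1) summable_abs_dominated) auto

lift_definition uminus_ell1 :: "ell1 \<Rightarrow> ell1" is "\<lambda>x i. - x i" by simp

lift_definition minus_ell1 :: "ell1 \<Rightarrow> ell1 \<Rightarrow> ell1" is "\<lambda>x y i. x i - y i"
  by (erule (1) summable_abs_dominated) auto

lift_definition scaleR_ell1 :: "real \<Rightarrow> ell1 \<Rightarrow> ell1" is "\<lambda>c x i. c * x i"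
  by (simp add: abs_mult summable_mult)

instance
  by standard (transfer; simp add: algebra_simps)+

end

lemma coord_simps [simp]:
  "coord 0 i = 0"
  "coord (x + y) i = coord x i + coord y i"
  "coord (- x) i = - coord x i"
  "coord (x - y) i = coord x i - coord y i"
  "coord (c *\<^sub>R x) i = c * coord x i"
  by (transfer; simp)+

instantiation ell1 :: real_normed_vector
begin

definition norm_ell1 :: "ell1 \<Rightarrow> real" where
  "norm (x :: ell1) = (\<Sum>i. \<bar>coord x i\<bar>)"

definition sgn_ell1 :: "ell1 \<Rightarrow> ell1" where
  "sgn (x :: ell1) = inverse (norm x) *\<^sub>R x"

definition dist_ell1 :: "ell1 \<Rightarrow> ell1 \<Rightarrow> real" where
  "dist (x :: ell1) y = norm (x - y)"

definition uniformity_ell1 :: "(ell1 \<times> ell1) filter" where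
  "uniformity_ell1 = (INF e\<in>{0<..}. principal {(x, y). dist x y < e})"

definition open_ell1 :: "ell1 set \<Rightarrow> bool" where
  "open_ell1 U = (\<forall>x\<in>U. eventually (\<lambda>(x', y). x' = x \<longrightarrow> y \<in> U) uniformity)"

instance
proof
  fix x y :: ell1 and c :: real
  show "norm x = 0 \<longleftrightarrow> x = 0"
    unfolding norm_ell1_def
    by (subst suminf_eq_zero_iff[OF summable_coord]) (auto intro: ell1_eqI)
  have "(\<Sum>i. \<bar>coord (x + y) i\<bar>) \<le> (\<Sum>i. \<bar>coord x i\<bar> + \<bar>coord y i\<bar>)"
    by (intro suminf_le summable_add summable_coord) auto
  then show "norm (x + y) \<le> norm x + norm y"
    unfolding norm_ell1_def by (simp add: suminf_add summable_coord)
  show "norm (c *\<^sub>R x) = \<bar>c\<bar> * norm x"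
    unfolding norm_ell1_def by (simp add: abs_mult suminf_mult summable_coord)
qed (simp_all add: sgn_ell1_def dist_ell1_def uniformity_ell1_def open_ell1_def)

end

lemma sum_le_norm_ell1: "finite A \<Longrightarrow> (\<Sum>i\<in>A. \<bar>coord x i\<bar>) \<le> norm x"
  unfolding norm_ell1_def by (intro sum_le_suminf summable_coord) auto

lemma abs_coord_le_norm: "\<bar>coord x i\<bar> \<le> norm x"
  using sum_le_norm_ell1[of "{i}" x] by simp

instance ell1 :: banach
proof
  fix X :: "nat \<Rightarrow> ell1"
  assume X: "Cauchy X"
  have "Cauchy (\<lambda>n. coord (X n) i)" for i
  proof (rule metric_CauchyI)
    fix e :: real assume "e > 0"
    then obtain M where "\<forall>m\<ge>M. \<forall>n\<ge>M. dist (X m) (X n) < e"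
      using X metric_CauchyD by blast
    then show "\<exists>M. \<forall>m\<ge>M. \<forall>n\<ge>M. dist (coord (X m) i) (coord (X n) i) < e"
      using abs_coord_le_norm[of "X _ - X _" i]
      by (metis coord_simps(4) dist_norm real_norm_def order_le_less_trans)
  qed
  then have "\<forall>i. \<exists>l. (\<lambda>n. coord (X n) i) \<longlonglongrightarrow> l"
    using Cauchy_convergent convergent_def by blast
  then obtain l where l: "\<And>i. (\<lambda>n. coord (X n) i) \<longlonglongrightarrow> l i" by metis
  have tail: "\<exists>M. \<forall>m\<ge>M. \<forall>k. (\<Sum>i<k. \<bar>coord (X m) i - l i\<bar>) \<le> e" if e: "e > 0" for e
  proof -
    obtain M where M: "\<And>m n. m \<ge> M \<Longrightarrow> n \<ge> M \<Longrightarrow> dist (X m) (X n) < e"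
      using X e metric_CauchyD by blast
    have "(\<Sum>i<k. \<bar>coord (X m) i - l i\<bar>) \<le> e" if m: "m \<ge> M" for m k
    proof (rule LIMSEQ_le_const2)
      show "(\<lambda>n. \<Sum>i<k. \<bar>coord (X m) i - coord (X n) i\<bar>) \<longlonglongrightarrow> (\<Sum>i<k. \<bar>coord (X m) i - l i\<bar>)"
        by (intro tendsto_intros l)
      have "(\<Sum>i<k. \<bar>coord (X m) i - coord (X n) i\<bar>) \<le> e" if "n \<ge> M" for n
        using sum_le_norm_ell1[of "{..<k}" "X m - X n"] M[OF m that] by (simp add: dist_norm)
      then show "\<exists>N. \<forall>n\<ge>N. (\<Sum>i<k. \<bar>coord (X m) i - coord (X n) i\<bar>) \<le> e" by blast
    qed
    then show ?thesis by blast
  qed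
  have summ: "summable (\<lambda>i. \<bar>coord (X m) i - l i\<bar>)"
    if "\<forall>k. (\<Sum>i<k. \<bar>coord (X m) i - l i\<bar>) \<le> e" for m e
    by (rule summableI_nonneg_bounded[where x = e]) (use that in auto)
  obtain M where M: "\<forall>k. (\<Sum>i<k. \<bar>coord (X M) i - l i\<bar>) \<le> 1"
    using tail[of 1] by auto
  have "summable (\<lambda>i. \<bar>l i\<bar>)"
    by (rule summable_comparison_test'[OF summable_add[OF summ[OF M] summable_coord[of "X M"]]])
      auto
  then have cl: "coord (Abs_ell1 l) = l" by (simp add: Abs_ell1_inverse)
  have "X \<longlonglongrightarrow> Abs_ell1 l"
  proof (rule metric_LIMSEQ_I)
    fix e :: real assume "e > 0"
    then obtain M where M: "\<forall>m\<ge>M. \<forall>k. (\<Sum>i<k. \<bar>coord (X m) i - l i\<bar>) \<le> e / 2"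
      using tail[of "e / 2"] by auto
    have "dist (X m) (Abs_ell1 l) < e" if "m \<ge> M" for m
    proof -
      have "(\<Sum>i. \<bar>coord (X m) i - l i\<bar>) \<le> e / 2"
        using M that by (intro suminf_le_const summ[where e = "e / 2"]) auto
      then show ?thesis using \<open>e > 0\<close> by (simp add: dist_norm norm_ell1_def cl)
    qed
    then show "\<exists>M. \<forall>m\<ge>M. dist (X m) (Abs_ell1 l) < e" by blast
  qed
  then show "convergent X" by (rule convergentI)
qed

instantiation ell1 :: "{ordered_real_vector, lattice_ab_group_add_abs}"
begin

definition less_eq_ell1 :: "ell1 \<Rightarrow> ell1 \<Rightarrow> bool" where
  "(x :: ell1) \<le> y \<longleftrightarrow> (\<forall>i. coord x i \<le> coord y i)"

definition less_ell1 :: "ell1 \<Rightarrow> ell1 \<Rightarrow> bool" where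
  "(x :: ell1) < y \<longleftrightarrow> x \<le> y \<and> \<not> y \<le> x"

lift_definition inf_ell1 :: "ell1 \<Rightarrow> ell1 \<Rightarrow> ell1" is "\<lambda>x y i. min (x i) (y i)"
  by (erule (1) summable_abs_dominated) auto

lift_definition sup_ell1 :: "ell1 \<Rightarrow> ell1 \<Rightarrow> ell1" is "\<lambda>x y i. max (x i) (y i)"
  by (erule (1) summable_abs_dominated) auto

lift_definition abs_ell1 :: "ell1 \<Rightarrow> ell1" is "\<lambda>x i. \<bar>x i\<bar>" by simp

instance
proof
  fix x y z :: ell1 and a b :: real
  show "x \<le> y \<Longrightarrow> y \<le> x \<Longrightarrow> x = y"
    unfolding less_eq_ell1_def by (intro ell1_eqI) (simp add: order_antisym)
  show "x \<le> y \<Longrightarrow> y \<le> z \<Longrightarrow> x \<le> z"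
    unfolding less_eq_ell1_def using order_trans by blast
  show "\<bar>x\<bar> = sup x (- x)" by transfer (auto simp: fun_eq_iff max_def)
qed (auto simp: less_eq_ell1_def less_ell1_def inf_ell1.rep_eq sup_ell1.rep_eq
      intro: mult_left_mono mult_right_mono)

end

section \<open>Operators and their matrices\<close>

type_synonym ell1_op = "ell1 \<Rightarrow>\<^sub>L ell1"

lift_definition unit_vec :: "nat \<Rightarrow> ell1" is "\<lambda>j i. if i = j then 1 else (0::real)"
  by (rule summable_finite[of "{_}"]) auto

definition entry :: "ell1_op \<Rightarrow> nat \<Rightarrow> nat \<Rightarrow> real" where
  "entry S i j = coord (blinfun_apply S (unit_vec j)) i"

text \<open>The bounded operator with a prescribed matrix (unspecified if there is none).\<close>

definition op_of_matrix :: "(nat \<Rightarrow> nat \<Rightarrow> real) \<Rightarrow> ell1_op" where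
  "op_of_matrix m = (THE S. \<forall>i j. entry S i j = m i j)"

definition op_abs :: "ell1_op \<Rightarrow> ell1_op" where
  "op_abs S = op_of_matrix (\<lambda>i j. \<bar>entry S i j\<bar>)"

definition op_pos :: "ell1_op \<Rightarrow> ell1_op" where
  "op_pos S = op_of_matrix (\<lambda>i j. max (entry S i j) 0)"

definition op_neg :: "ell1_op \<Rightarrow> ell1_op" where
  "op_neg S = op_of_matrix (\<lambda>i j. max (- entry S i j) 0)"

definition has_positive_eigenvector :: "ell1_op \<Rightarrow> bool" where
  "has_positive_eigenvector S \<longleftrightarrow>
     (\<exists>x c. x \<noteq> 0 \<and> 0 \<le> x \<and> blinfun_apply S x = c *\<^sub>R x)"

definition lattice_ideal :: "ell1 set \<Rightarrow> bool" where
  "lattice_ideal I \<longleftrightarrow> subspace I \<and> (\<forall>x\<in>I. \<forall>y. \<bar>y\<bar> \<le> \<bar>x\<bar> \<longrightarrow> y \<in> I)"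

definition has_invariant_ideal :: "ell1_op \<Rightarrow> bool" where
  "has_invariant_ideal S \<longleftrightarrow>
     (\<exists>I. lattice_ideal I \<and> closed I \<and> I \<noteq> {0} \<and> I \<noteq> UNIV \<and> blinfun_apply S ` I \<subseteq> I)"

section \<open>Read's operator\<close>

text \<open>
  The sequence \<open>d = (a\<^sub>1, b\<^sub>1, a\<^sub>2, b\<^sub>2, \<dots>)\<close> is indexed from 0, so that
  \<open>a\<^sub>n = d (2n - 2)\<close> and \<open>b\<^sub>n = d (2n - 1)\<close> for \<open>n \<ge> 1\<close>.  The value
  \<open>seq_b d 0\<close> is meaningless and never used.
\<close>

definition seq_a :: "(nat \<Rightarrow> nat) \<Rightarrow> nat \<Rightarrow> nat" where
  "seq_a d n = (if n = 0 then 1 else d (2 * n - 2))"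

definition seq_b :: "(nat \<Rightarrow> nat) \<Rightarrow> nat \<Rightarrow> nat" where
  "seq_b d n = d (2 * n - 1)"

definition seq_v :: "(nat \<Rightarrow> nat) \<Rightarrow> nat \<Rightarrow> nat" where
  "seq_v d n = (if n = 0 then 0 else n * (seq_a d n + seq_b d n))"

text \<open>
  The list arguments of \<open>G\<close> and \<open>H\<close> are \<open>a\<^sub>0, a\<^sub>1, b\<^sub>1, \<dots>, a\<^bsub>n-1\<^esub>, b\<^bsub>n-1\<^esub>\<close>
  and \<open>a\<^sub>0, a\<^sub>1, b\<^sub>1, \<dots>, a\<^bsub>n-1\<^esub>, b\<^bsub>n-1\<^esub>, a\<^sub>n\<close>, respectively.
\<close>

definition increases_at_least ::
  "(nat \<Rightarrow> nat list \<Rightarrow> nat) \<Rightarrow> (nat \<Rightarrow> nat list \<Rightarrow> nat) \<Rightarrow> (nat \<Rightarrow> nat) \<Rightarrow> bool" where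
  "increases_at_least G H d \<longleftrightarrow>
     (\<forall>n\<ge>1. seq_a d n \<ge> G n (seq_a d 0 # map d [0..<2 * n - 2]) \<and>
            seq_b d n \<ge> H n (seq_a d 0 # map d [0..<2 * n - 1]))"

definition provided_rapidly_increasing :: "((nat \<Rightarrow> nat) \<Rightarrow> bool) \<Rightarrow> bool" where
  "provided_rapidly_increasing P \<longleftrightarrow>
     (\<exists>G H. (\<forall>n xs. G n xs > 0 \<and> H n xs > 0) \<and>
        (\<forall>d. strict_mono d \<and> (\<forall>i. d i > 0) \<and> increases_at_least G H d \<longrightarrow> P d))"

definition read_vectors :: "(nat \<Rightarrow> nat) \<Rightarrow> (nat \<Rightarrow> ell1) \<Rightarrow> bool" where
  "read_vectors d e \<longleftrightarrow>
    (let a = seq_a d; b = seq_b d; v = seq_v d; f = unit_vec in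
      (\<forall>i. e i \<in> span (range f)) \<and>
      f 0 = e 0 \<and>
      (\<forall>r n i. 0 < r \<and> r \<le> n \<and> i \<in> {r * a n..v (n - r) + r * a n} \<longrightarrow>
        f i = (real (n - r) ^ (i - r * a n) * real (a (n - r))) *\<^sub>R
              (real n ^ (r * a n) *\<^sub>R e i - e (i - r * a n))) \<and>
      (\<forall>r n i. 0 < r \<and> r < n \<and> i \<in> {r * a n + v (n - r)<..<(r + 1) * a n} \<longrightarrow>
        f i = (real n ^ i *
               2 powr (((real r + 1/2) * real (a n) - real i) / sqrt (real (a n)))) *\<^sub>R e i) \<and>
      (\<forall>n i. 1 \<le> n \<and> i \<in> {v (n - 1)<..<a n} \<longrightarrow>
        f i = (real n ^ i *
               2 powr ((1/2 * real (a n) - real i) / sqrt (real (a n)))) *\<^sub>R e i) \<and>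
      (\<forall>r n i. 0 < r \<and> r \<le> n \<and> i \<in> {r * (a n + b n)..n * a n + r * b n} \<longrightarrow>
        f i = real n ^ i *\<^sub>R e i - (real (b n) * real n ^ (i - b n)) *\<^sub>R e (i - b n)) \<and>
      (\<forall>r n i. r < n \<and> i \<in> {n * a n + r * b n<..<(r + 1) * (a n + b n)} \<longrightarrow>
        f i = (real n ^ i *
               2 powr (((real r + 1/2) * real (b n) - real i) / sqrt (real (b n)))) *\<^sub>R e i))"

text \<open>
  Both descriptions below determine their object uniquely only when \<open>d\<close> increases
  sufficiently rapidly; for other \<open>d\<close> the value may be unspecified.
\<close>

definition read_vec :: "(nat \<Rightarrow> nat) \<Rightarrow> nat \<Rightarrow> ell1" where
  "read_vec d = (THE e. read_vectors d e)"

definition read_operator :: "(nat \<Rightarrow> nat) \<Rightarrow> ell1_op" where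
  "read_operator d = (THE T. \<forall>i. blinfun_apply T (read_vec d i) = read_vec d (Suc i))"

end

theory Submission
  imports Defs "HOL-Real_Asymp.Real_Asymp"
begin

text \<open>
  Write \<open>f\<^sub>j\<close> for the unit vectors.  The construction is triangular: every clause reads
  \<open>f\<^sub>i = \<alpha>\<^sub>i e\<^sub>i - \<gamma>\<^sub>i e\<^sub>p\<close> with \<open>\<alpha>\<^sub>i > 0\<close>, \<open>\<gamma>\<^sub>i \<ge> 0\<close> and an index \<open>p = p(i) < i\<close>.  Hence the
  \<open>e\<^sub>i\<close> exist, are unique and have nonnegative coordinates, and
  \<open>T f\<^sub>j = \<alpha>\<^sub>j e\<^bsub>j+1\<^esub> - \<gamma>\<^sub>j e\<^bsub>p(j)+1\<^esub>\<close> has the coordinate \<open>\<alpha>\<^sub>j / \<alpha>\<^bsub>j+1\<^esub> > 0\<close> at \<open>j + 1\<close> and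
  none beyond.

  No invariant ideals.  A nonzero closed ideal of \<open>\<ell>\<^sub>1\<close> contains a unit vector and is determined by
  the unit vectors in it, so it is enough that the nonzero entries of the matrix connect any index
  to any other.  The subdiagonal leads upwards from every index, and since
  \<open>e\<^bsub>na\<^sub>n\<^esub>\<close> is a positive combination of \<open>f\<^bsub>na\<^sub>n\<^esub>\<close> and \<open>f\<^sub>0\<close>, the column \<open>n a\<^sub>n - 1\<close>, where
  \<open>\<gamma> = 0\<close>, leads back to \<open>0\<close>.  These entries of \<open>T\<close> are positive, hence shared by \<open>T\<^sup>+\<close> and
  \<open>|T|\<close> (lemma \<open>no_invariant_ideal\<close>).

  Eigenvectors.  For \<open>T\<^sup>-\<close> the vector \<open>f\<^sub>0\<close> is one, with eigenvalue \<open>0\<close>: \<open>T f\<^sub>0 = e\<^sub>1 \<ge> 0\<close>.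
  For \<open>T\<^sup>+\<close> and \<open>|T|\<close> the argument is of Krein--Rutman type (theorem
  \<open>positive_eigenvectorI\<close>).  The cycle \<open>0, 1, \<dots>, a\<^sub>1 - 1, 0\<close> of positive entries keeps
  the Perron eigenvalues of the finite sections above a fixed \<open>\<delta> > 0\<close>, and normalized Perron
  eigenvectors converge along a subsequence once their mass cannot escape to infinity.
  It cannot, because \<open>T\<close> is a weighted shift plus a compact operator, and the shift contracts far
  out in a suitable equivalent norm (lemmas \<open>column_cases\<close> and \<open>tail_estimate\<close>).
  Indeed, in blocks of level \<open>n\<close> most shift weights are at most \<open>2/n\<close>.  The exceptions are
  the blocks of clause A, where the weight is \<open>1/k\<close> with \<open>k = n - r\<close>; for each of the finitely many
  \<open>k\<close> for which \<open>1/k\<close> is not small, such a block has the fixed length \<open>v\<^sub>k\<close>, so that a geometric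
  weight along it makes up for it at bounded cost.  At the ends of the blocks everything is
  small by the rapid growth of the sequence, except for one negative entry of size at most
  \<open>1/(k + 1)\<close> that always sits in row \<open>v\<^sub>k + 1\<close>.
\<close>

section \<open>Operators on the sequence space given by their columns\<close>

lemma coord_unit_vec: "coord (unit_vec j) i = (if i = j then 1 else 0)"
  by (simp add: unit_vec.rep_eq)

lemma norm_unit_vec: "norm (unit_vec j) = 1"
proof -
  have "(\<lambda>i. \<bar>coord (unit_vec j) i\<bar>) = (\<lambda>i. if i = j then 1 else 0)"
    by (auto simp: coord_unit_vec)
  then show ?thesis
    unfolding norm_ell1_def using sums_single[of j "\<lambda>_. 1::real"] by (simp add: sums_iff)
qed

lemma unit_vec_neq_0: "unit_vec j \<noteq> 0"
  using norm_unit_vec[of j] by force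

lemma bounded_linear_coord: "bounded_linear (\<lambda>x. coord x i)"
  by (rule bounded_linear_intro[where K = 1]) (auto simp: abs_coord_le_norm)

lemmas tendsto_coord = bounded_linear.tendsto[OF bounded_linear_coord]

lemma unit_vec_expansion: "(\<lambda>j. coord x j *\<^sub>R unit_vec j) sums x"
proof -
  have s: "summable (\<lambda>j. coord x j *\<^sub>R unit_vec j)"
    by (rule summable_norm_cancel) (simp add: norm_unit_vec summable_coord)
  have "coord (\<Sum>j. coord x j *\<^sub>R unit_vec j) i = coord x i" for i
  proof -
    have "(\<lambda>j. coord (coord x j *\<^sub>R unit_vec j) i) sums coord (\<Sum>j. coord x j *\<^sub>R unit_vec j) i"
      by (rule bounded_linear.sums[OF bounded_linear_coord summable_sums[OF s]])
    moreover have "(\<lambda>j. coord (coord x j *\<^sub>R unit_vec j) i) = (\<lambda>j. if j = i then coord x j else 0)"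
      by (auto simp: coord_unit_vec)
    ultimately show ?thesis using sums_single[of i "coord x"] sums_unique2 by metis
  qed
  then have "(\<Sum>j. coord x j *\<^sub>R unit_vec j) = x" by (rule ell1_eqI)
  then show ?thesis using summable_sums[OF s] by simp
qed

lemma blinfun_column_expansion:
  fixes S :: ell1_op
  shows "(\<lambda>j. coord x j *\<^sub>R S (unit_vec j)) sums S x"
  using bounded_linear.sums[OF blinfun.bounded_linear_right unit_vec_expansion[of x], of S]
  by (simp add: blinfun.scaleR_right)

lemma blinfun_eqI_unit_vec:
  fixes S S' :: ell1_op
  assumes "\<And>j. S (unit_vec j) = S' (unit_vec j)"
  shows "S = S'"
  using blinfun_column_expansion[of _ S] blinfun_column_expansion[of _ S'] sums_unique2
  by (metis (no_types, lifting) assms blinfun_eqI ext)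

lemma coord_blinfun_sums:
  fixes S :: ell1_op
  shows "(\<lambda>j. entry S i j * coord x j) sums coord (S x) i"
  using bounded_linear.sums[OF bounded_linear_coord blinfun_column_expansion[of x S], of i]
  by (simp add: entry_def mult.commute)

lemma coord_blinfun_finite_support:
  fixes S :: ell1_op
  assumes "\<And>j. j \<ge> N \<Longrightarrow> coord x j = 0"
  shows "coord (S x) i = (\<Sum>j<N. entry S i j * coord x j)"
  using sums_unique[OF coord_blinfun_sums[of S i x]]
    suminf_finite[of "{..<N}" "\<lambda>j. entry S i j * coord x j"] assms
  by (metis finite_lessThan lessThan_iff mult_zero_right not_le_imp_less)

lemma blinfun_with_columns:
  fixes c :: "nat \<Rightarrow> ell1"
  assumes bdd: "\<And>j. norm (c j) \<le> C"
  obtains S :: ell1_op where "\<And>j. S (unit_vec j) = c j"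
proof -
  let ?g = "\<lambda>x j. coord x j *\<^sub>R c j"
  have nb: "norm (?g x j) \<le> \<bar>coord x j\<bar> * C" for x j
    using bdd[of j] by (simp add: mult_left_mono)
  have sn: "summable (\<lambda>j. norm (?g x j))" for x
    by (rule summable_comparison_test'[OF summable_mult2[OF summable_coord[of x], of C], of 0])
      (use nb in auto)
  have s: "summable (?g x)" for x
    by (rule summable_norm_cancel[OF sn])
  have bl: "bounded_linear (\<lambda>x. \<Sum>j. ?g x j)"
  proof (rule bounded_linear_intro[where K = C])
    show "(\<Sum>j. ?g (x + y) j) = (\<Sum>j. ?g x j) + (\<Sum>j. ?g y j)" for x y
      by (simp add: suminf_add[OF s s] scaleR_add_left)
    show "(\<Sum>j. ?g (r *\<^sub>R x) j) = r *\<^sub>R (\<Sum>j. ?g x j)" for r x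
      using suminf_scaleR_right[OF s, of r x] by simp
    show "norm (\<Sum>j. ?g x j) \<le> norm x * C" for x
    proof -
      have "norm (\<Sum>j. ?g x j) \<le> (\<Sum>j. norm (?g x j))" by (rule summable_norm[OF sn])
      also have "\<dots> \<le> (\<Sum>j. \<bar>coord x j\<bar> * C)"
        by (intro suminf_le nb sn summable_mult2 summable_coord)
      also have "\<dots> = norm x * C" by (simp add: norm_ell1_def suminf_mult2 summable_coord)
      finally show ?thesis .
    qed
  qed
  have "blinfun_apply (Blinfun (\<lambda>x. \<Sum>j. ?g x j)) (unit_vec i) = c i" for i
  proof -
    have "?g (unit_vec i) = (\<lambda>j. if j = i then c j else 0)"
      by (auto simp: coord_unit_vec)
    then show ?thesis
      using sums_single[of i c] by (simp add: bounded_linear_Blinfun_apply[OF bl] sums_iff)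
  qed
  then show ?thesis using that by blast
qed

text \<open>
  The matrix to be realized is dominated entrywise by that of a bounded operator, so its columns
  are uniformly bounded in norm; this makes the definite description in \<open>op_of_matrix\<close> proper.
\<close>

lemma entry_op_of_matrix:
  assumes dom: "\<And>i j. \<bar>m i j\<bar> \<le> \<bar>entry S i j\<bar>"
  shows "entry (op_of_matrix m) i j = m i j"
proof -
  define c where "c j = Abs_ell1 (\<lambda>i. m i j)" for j
  have sm: "summable (\<lambda>i. \<bar>m i j\<bar>)" for j
    by (rule summable_comparison_test'[OF summable_coord[of "S (unit_vec j)"], of 0])
      (use dom in \<open>auto simp: entry_def\<close>)
  have c: "coord (c j) = (\<lambda>i. m i j)" for j
    unfolding c_def by (rule Abs_ell1_inverse) (use sm in simp)
  have "norm (c j) \<le> norm S" for j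
  proof -
    have "norm (c j) \<le> norm (S (unit_vec j))"
      unfolding norm_ell1_def c
      by (intro suminf_le sm summable_coord) (use dom in \<open>auto simp: entry_def\<close>)
    also have "\<dots> \<le> norm S" using norm_blinfun[of S "unit_vec j"] by (simp add: norm_unit_vec)
    finally show ?thesis .
  qed
  then obtain S' :: ell1_op where S': "\<And>j. S' (unit_vec j) = c j"
    using blinfun_with_columns by blast
  have "op_of_matrix m = S'" unfolding op_of_matrix_def
  proof (rule the_equality)
    show "\<forall>i j. entry S' i j = m i j" by (simp add: entry_def S' c)
    show "S'' = S'" if "\<forall>i j. entry S'' i j = m i j" for S''
      by (intro blinfun_eqI_unit_vec ell1_eqI) (use that in \<open>simp add: entry_def S' c\<close>)
  qed
  then show ?thesis by (simp add: entry_def S' c)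
qed

lemma entry_op_abs: "entry (op_abs S) i j = \<bar>entry S i j\<bar>"
  unfolding op_abs_def by (rule entry_op_of_matrix[where S = S]) auto

lemma entry_op_pos: "entry (op_pos S) i j = max (entry S i j) 0"
  unfolding op_pos_def by (rule entry_op_of_matrix[where S = S]) auto

lemma entry_op_neg: "entry (op_neg S) i j = max (- entry S i j) 0"
  unfolding op_neg_def by (rule entry_op_of_matrix[where S = S]) auto

section \<open>Irreducible matrices have no invariant ideals\<close>

text \<open>
  An ideal that contains \<open>x\<close> contains \<open>f\<^sub>i\<close> for each \<open>i\<close> in the support of \<open>x\<close>.  Applied to
  \<open>x = S f\<^sub>j\<close>, this lets one travel along the nonzero entries: up the subdiagonal as far as a column
  that reaches row \<open>0\<close>, and from \<open>0\<close> to everywhere.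
\<close>

lemma no_invariant_ideal:
  assumes up: "\<And>j. entry S (Suc j) j \<noteq> 0"
    and down: "\<And>j. \<exists>m\<ge>j. entry S 0 m \<noteq> 0"
  shows "\<not> has_invariant_ideal S"
proof
  assume "has_invariant_ideal S"
  then obtain I where I: "subspace I" "\<And>x y. x \<in> I \<Longrightarrow> \<bar>y\<bar> \<le> \<bar>x\<bar> \<Longrightarrow> y \<in> I" "closed I"
      "I \<noteq> {0}" "I \<noteq> UNIV" "\<And>x. x \<in> I \<Longrightarrow> S x \<in> I"
    unfolding has_invariant_ideal_def lattice_ideal_def by blast
  have unit: "unit_vec i \<in> I" if x: "x \<in> I" "coord x i \<noteq> 0" for x i
  proof -
    have "\<bar>coord x i *\<^sub>R unit_vec i\<bar> \<le> \<bar>x\<bar>"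
      by (auto simp: less_eq_ell1_def abs_ell1.rep_eq coord_unit_vec)
    then have "coord x i *\<^sub>R unit_vec i \<in> I" using I(2) x(1) by blast
    then have "(1 / coord x i) *\<^sub>R (coord x i *\<^sub>R unit_vec i) \<in> I"
      using I(1) subspace_scale by blast
    then show ?thesis using x(2) by simp
  qed
  have step: "unit_vec i \<in> I" if "unit_vec j \<in> I" "entry S i j \<noteq> 0" for i j
    using unit[of "S (unit_vec j)" i] I(6) that by (auto simp: entry_def)
  have climb: "unit_vec (j + k) \<in> I" if "unit_vec j \<in> I" for j k
    by (induction k) (use that step up in auto)
  obtain x where "x \<in> I" "x \<noteq> 0" using I(1,4) subspace_0 by blast
  then obtain j where "coord x j \<noteq> 0" using ell1_eqI[of x 0] by auto
  then have j: "unit_vec j \<in> I" using unit \<open>x \<in> I\<close> by blast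
  obtain m where "m \<ge> j" "entry S 0 m \<noteq> 0" using down by blast
  then have "unit_vec 0 \<in> I" using step climb[OF j, of "m - j"] by simp
  then have all: "unit_vec i \<in> I" for i using climb[of 0 i] by simp
  have "y \<in> I" for y
  proof -
    have "(\<lambda>n. \<Sum>j<n. coord y j *\<^sub>R unit_vec j) \<longlonglongrightarrow> y"
      using unit_vec_expansion[of y] by (simp add: sums_def)
    moreover have "(\<Sum>j<n. coord y j *\<^sub>R unit_vec j) \<in> I" for n
      by (intro subspace_sum[OF I(1)] subspace_scale[OF I(1)] all)
    ultimately show ?thesis using closed_sequentially[OF I(3)] by metis
  qed
  then show False using I(5) by blast
qed

section \<open>Positive eigenvectors of nonnegative matrices\<close>

lemma coordinatewise_convergent_subsequence:
  fixes X :: "nat \<Rightarrow> nat \<Rightarrow> real"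
  assumes "\<And>n i. \<bar>X n i\<bar> \<le> B"
  obtains l r where "strict_mono (r :: nat \<Rightarrow> nat)" "\<And>i. (\<lambda>n. X (r n) i) \<longlonglongrightarrow> l i"
proof -
  have "compact (PiE UNIV (\<lambda>i::nat. {-B..B}))"
    using compactin_PiE[where X = "\<lambda>i::nat. euclidean :: real topology" and I = UNIV and S = "\<lambda>i. {-B..B}"]
    by (simp add: euclidean_product_topology)
  then have "seq_compact (PiE UNIV (\<lambda>i::nat. {-B..B}))"
    by (simp add: seq_compact_eq_compact)
  moreover have "X n \<in> PiE UNIV (\<lambda>i::nat. {-B..B})" for n
    using assms[of n] by (auto simp: abs_le_iff) (smt (verit))
  ultimately obtain l r where r: "strict_mono (r :: nat \<Rightarrow> nat)" "(X \<circ> r) \<longlonglongrightarrow> l"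
    unfolding seq_compact_def by metis
  have "(\<lambda>n. X (r n) i) \<longlonglongrightarrow> l i" for i
  proof -
    have "isCont (\<lambda>f::nat \<Rightarrow> real. f i) l"
      using continuous_on_product_coordinates[of i] continuous_on_eq_continuous_at by blast
    from isCont_tendsto_compose[OF this r(2)] show ?thesis by (simp add: o_def)
  qed
  with r(1) show ?thesis using that by blast
qed

text \<open>
  Relative compactness in \<open>\<ell>\<^sub>1\<close>: bounded sequences have coordinatewise convergent subsequences,
  and uniformly small tails turn coordinatewise convergence into convergence in norm.
\<close>

lemma ell1_convergent_subsequence:
  fixes X :: "nat \<Rightarrow> ell1"
  assumes bdd: "\<And>n. norm (X n) \<le> B"
    and tail: "\<And>\<epsilon>. \<epsilon> > 0 \<Longrightarrow> \<exists>R. \<forall>\<^sub>F n in sequentially. \<forall>N. (\<Sum>i=R..<N. \<bar>coord (X n) i\<bar>) \<le> \<epsilon>"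
  obtains x r where "strict_mono (r :: nat \<Rightarrow> nat)" "(\<lambda>n. X (r n)) \<longlonglongrightarrow> x"
proof -
  have "\<bar>coord (X n) i\<bar> \<le> B" for n i
    using abs_coord_le_norm[of "X n" i] bdd[of n] by simp
  then obtain l r where r: "strict_mono (r :: nat \<Rightarrow> nat)"
    and l: "\<And>i. (\<lambda>n. coord (X (r n)) i) \<longlonglongrightarrow> l i"
    using coordinatewise_convergent_subsequence[of "\<lambda>n. coord (X n)" B] by metis
  have ltail: "\<exists>R. (\<forall>\<^sub>F n in sequentially. \<forall>N. (\<Sum>i=R..<N. \<bar>coord (X (r n)) i\<bar>) \<le> \<epsilon>)
      \<and> (\<forall>N. (\<Sum>i=R..<N. \<bar>l i\<bar>) \<le> \<epsilon>)" if \<epsilon>: "\<epsilon> > 0" for \<epsilon>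
  proof -
    obtain R where R: "\<forall>\<^sub>F n in sequentially. \<forall>N. (\<Sum>i=R..<N. \<bar>coord (X n) i\<bar>) \<le> \<epsilon>"
      using tail[OF \<epsilon>] by blast
    have R': "\<forall>\<^sub>F n in sequentially. \<forall>N. (\<Sum>i=R..<N. \<bar>coord (X (r n)) i\<bar>) \<le> \<epsilon>"
      using filterlim_subseq[OF r] R by (auto simp: filterlim_iff)
    have "(\<Sum>i=R..<N. \<bar>l i\<bar>) \<le> \<epsilon>" for N
    proof (rule tendsto_upperbound)
      show "(\<lambda>n. \<Sum>i=R..<N. \<bar>coord (X (r n)) i\<bar>) \<longlonglongrightarrow> (\<Sum>i=R..<N. \<bar>l i\<bar>)"
        by (intro tendsto_intros l)
    qed (use R' in \<open>auto elim: eventually_mono\<close>)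
    with R' show ?thesis by blast
  qed
  have "summable (\<lambda>i. \<bar>l i\<bar>)"
  proof (rule summableI_nonneg_bounded)
    show "(\<Sum>i<N. \<bar>l i\<bar>) \<le> B" for N
    proof (rule tendsto_upperbound)
      show "(\<lambda>n. \<Sum>i<N. \<bar>coord (X (r n)) i\<bar>) \<longlonglongrightarrow> (\<Sum>i<N. \<bar>l i\<bar>)"
        by (intro tendsto_intros l)
      have "(\<Sum>i<N. \<bar>coord (X (r n)) i\<bar>) \<le> B" for n
        using sum_le_norm_ell1[of "{..<N}" "X (r n)"] bdd[of "r n"] by simp
      then show "\<forall>\<^sub>F n in sequentially. (\<Sum>i<N. \<bar>coord (X (r n)) i\<bar>) \<le> B" by simp
    qed simp
  qed simp
  then have cl: "coord (Abs_ell1 l) = l" by (simp add: Abs_ell1_inverse)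
  have "(\<lambda>n. X (r n)) \<longlonglongrightarrow> Abs_ell1 l"
  proof (rule tendstoI)
    fix \<epsilon> :: real assume e: "\<epsilon> > 0"
    then obtain R where R: "\<forall>\<^sub>F n in sequentially. \<forall>N. (\<Sum>i=R..<N. \<bar>coord (X (r n)) i\<bar>) \<le> \<epsilon>/4"
        "\<And>N. (\<Sum>i=R..<N. \<bar>l i\<bar>) \<le> \<epsilon>/4"
      using ltail[of "\<epsilon>/4"] by auto
    have "(\<lambda>n. \<Sum>i<R. \<bar>coord (X (r n)) i - l i\<bar>) \<longlonglongrightarrow> (\<Sum>i<R. \<bar>l i - l i\<bar>)"
      by (intro tendsto_intros l)
    then have "\<forall>\<^sub>F n in sequentially. (\<Sum>i<R. \<bar>coord (X (r n)) i - l i\<bar>) < \<epsilon>/4"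
      by (rule order_tendstoD(2)) (use e in auto)
    then show "\<forall>\<^sub>F n in sequentially. dist (X (r n)) (Abs_ell1 l) < \<epsilon>"
      using R(1)
    proof eventually_elim
      case (elim n)
      have "(\<Sum>i<N. \<bar>coord (X (r n) - Abs_ell1 l) i\<bar>) \<le> 3*\<epsilon>/4" for N
      proof -
        have "(\<Sum>i<N. \<bar>coord (X (r n)) i - l i\<bar>) \<le> (\<Sum>i<max R N. \<bar>coord (X (r n)) i - l i\<bar>)"
          by (rule sum_mono2) auto
        also have "{..<max R N} = {..<R} \<union> {R..<max R N}" by auto
        also have "(\<Sum>i\<in>\<dots>. \<bar>coord (X (r n)) i - l i\<bar>)
            = (\<Sum>i<R. \<bar>coord (X (r n)) i - l i\<bar>) + (\<Sum>i=R..<max R N. \<bar>coord (X (r n)) i - l i\<bar>)"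
          by (rule sum.union_disjoint) auto
        also have "(\<Sum>i=R..<max R N. \<bar>coord (X (r n)) i - l i\<bar>)
            \<le> (\<Sum>i=R..<max R N. \<bar>coord (X (r n)) i\<bar> + \<bar>l i\<bar>)"
          by (rule sum_mono) auto
        also have "\<dots> \<le> \<epsilon>/4 + \<epsilon>/4"
          unfolding sum.distrib using elim(2) R(2) by (intro add_mono) auto
        finally show ?thesis using elim(1) by (simp add: cl)
      qed
      then have "norm (X (r n) - Abs_ell1 l) \<le> 3*\<epsilon>/4"
        unfolding norm_ell1_def by (intro suminf_le_const summable_coord) auto
      then show ?case using e by (simp add: dist_norm)
    qed
  qed
  with r show ?thesis using that by blast
qed

text \<open>
  Perron's theorem by the Collatz--Wielandt variational principle.  The largest \<open>\<mu>\<close> with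
  \<open>\<mu> x \<le> A x\<close> for some \<open>x\<close> in the simplex is attained by compactness.  If \<open>A x \<noteq> \<mu> x\<close>, then
  \<open>A (A x - \<mu> x)\<close> is strictly positive, so that \<open>A x\<close>, after normalization, would admit a larger
  \<open>\<mu>\<close>.  The point \<open>y\<close> of the simplex yields the lower bound \<open>\<delta>\<close>.
\<close>

lemma positive_matrix_eigenvector:
  fixes A :: "nat \<Rightarrow> nat \<Rightarrow> real"
  assumes pos: "\<And>i j. i < N \<Longrightarrow> j < N \<Longrightarrow> A i j > 0"
    and y: "\<And>i. i < N \<Longrightarrow> 0 \<le> y i" "(\<Sum>i<N. y i) = 1"
    and \<delta>: "0 \<le> \<delta>" "\<And>i. i < N \<Longrightarrow> \<delta> * y i \<le> (\<Sum>j<N. A i j * y j)"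
  obtains x \<mu> where "\<delta> \<le> \<mu>" "\<And>i. 0 \<le> x i" "\<And>i. N \<le> i \<Longrightarrow> x i = 0" "(\<Sum>i<N. x i) = 1"
    "\<And>i. i < N \<Longrightarrow> (\<Sum>j<N. A i j * x j) = \<mu> * x i"
proof -
  define K where "K = {x::nat \<Rightarrow> real. (\<forall>i. 0 \<le> x i) \<and> (\<forall>i\<ge>N. x i = 0) \<and> (\<Sum>i<N. x i) = 1}"
  define \<Lambda> where "\<Lambda> = {\<mu>. \<exists>x\<in>K. \<forall>i<N. \<mu> * x i \<le> (\<Sum>j<N. A i j * x j)}"
  have le1: "x i \<le> 1" if "x \<in> K" for x i
  proof (cases "i < N")
    case True
    then have "x i \<le> (\<Sum>i<N. x i)" using that by (intro member_le_sum) (auto simp: K_def)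
    then show ?thesis using that by (simp add: K_def)
  qed (use that in \<open>auto simp: K_def\<close>)
  have "(\<lambda>i. if i < N then y i else 0) \<in> K" using y by (auto simp: K_def)
  then have \<delta>\<Lambda>: "\<delta> \<in> \<Lambda>" unfolding \<Lambda>_def
    using \<delta>(2) by (auto intro!: bexI[of _ "\<lambda>i. if i < N then y i else 0"])
  have bdd: "\<mu> \<le> (\<Sum>i<N. \<Sum>j<N. A i j)" if \<mu>: "\<mu> \<in> \<Lambda>" for \<mu>
  proof -
    obtain x where x: "x \<in> K" "\<And>i. i < N \<Longrightarrow> \<mu> * x i \<le> (\<Sum>j<N. A i j * x j)"
      using \<mu> unfolding \<Lambda>_def by blast
    have "\<mu> = (\<Sum>i<N. \<mu> * x i)" using x(1) by (simp add: K_def sum_distrib_left[symmetric])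
    also have "\<dots> \<le> (\<Sum>i<N. \<Sum>j<N. A i j * x j)" by (intro sum_mono x(2)) auto
    also have "\<dots> \<le> (\<Sum>i<N. \<Sum>j<N. A i j)"
    proof (intro sum_mono)
      fix i j assume "i \<in> {..<N}" "j \<in> {..<N}"
      then show "A i j * x j \<le> A i j"
        using pos[of i j] le1[OF x(1), of j] x(1) by (simp add: K_def mult_left_le)
    qed
    finally show ?thesis .
  qed
  then have bddA: "bdd_above \<Lambda>" by (auto simp: bdd_above_def)
  define s where "s = Sup \<Lambda>"
  have "\<delta> \<le> s" unfolding s_def by (rule cSup_upper[OF \<delta>\<Lambda> bddA])
  have "\<exists>\<mu>\<in>\<Lambda>. s - 1 / Suc n < \<mu>" for n
    unfolding s_def by (rule less_cSupD) (use \<delta>\<Lambda> in auto)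
  then obtain m where m: "\<And>n. m n \<in> \<Lambda>" "\<And>n. s - 1 / Suc n < m n" by metis
  then obtain X where X: "\<And>n. X n \<in> K"
      "\<And>n i. i < N \<Longrightarrow> m n * X n i \<le> (\<Sum>j<N. A i j * X n j)"
    unfolding \<Lambda>_def by (simp add: Bex_def) metis
  have "\<bar>X n i\<bar> \<le> 1" for n i using le1[OF X(1), of n i] X(1)[of n] by (simp add: K_def)
  then obtain x r where r: "strict_mono (r :: nat \<Rightarrow> nat)" "\<And>i. (\<lambda>n. X (r n) i) \<longlonglongrightarrow> x i"
    using coordinatewise_convergent_subsequence by blast
  have "m \<longlonglongrightarrow> s"
  proof (rule tendsto_sandwich)
    show "\<forall>\<^sub>F n in sequentially. s - 1 / Suc n \<le> m n" using m(2) by (simp add: less_imp_le)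
    show "\<forall>\<^sub>F n in sequentially. m n \<le> s"
      unfolding s_def using m(1) cSup_upper[OF _ bddA] by simp
    show "(\<lambda>n. s - 1 / Suc n) \<longlonglongrightarrow> s"
      using tendsto_diff[OF tendsto_const LIMSEQ_inverse_real_of_nat, of s]
      by (simp add: inverse_eq_divide)
  qed simp
  then have mr: "(\<lambda>n. m (r n)) \<longlonglongrightarrow> s" using r(1) LIMSEQ_subseq_LIMSEQ by (auto simp: o_def)
  have x0: "0 \<le> x i" for i
    by (rule LIMSEQ_le_const[OF r(2)]) (use X(1) in \<open>auto simp: K_def\<close>)
  have xN: "x i = 0" if "i \<ge> N" for i
  proof -
    have "(\<lambda>n. X (r n) i) = (\<lambda>n. 0)" using X(1) that by (auto simp: K_def)
    then show ?thesis using r(2)[of i] by (metis LIMSEQ_const_iff)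
  qed
  have x1: "(\<Sum>i<N. x i) = 1"
  proof -
    have "(\<lambda>n. \<Sum>i<N. X (r n) i) \<longlonglongrightarrow> (\<Sum>i<N. x i)" by (intro tendsto_intros r)
    moreover have "(\<lambda>n. \<Sum>i<N. X (r n) i) = (\<lambda>n. 1)" using X(1) by (auto simp: K_def)
    ultimately show ?thesis by (metis LIMSEQ_const_iff)
  qed
  have sx: "s * x i \<le> (\<Sum>j<N. A i j * x j)" if "i < N" for i
  proof (rule LIMSEQ_le)
    show "(\<lambda>n. m (r n) * X (r n) i) \<longlonglongrightarrow> s * x i" by (intro tendsto_intros mr r)
    show "(\<lambda>n. \<Sum>j<N. A i j * X (r n) j) \<longlonglongrightarrow> (\<Sum>j<N. A i j * x j)" by (intro tendsto_intros r)
  qed (use X(2) that in auto)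
  define w where "w i = (if i < N then \<Sum>j<N. A i j * x j else 0)" for i
  have "w i = s * x i" if i: "i < N" for i
  proof (rule ccontr)
    assume neq: "w i \<noteq> s * x i"
    define z where "z i = w i - s * x i" for i
    have z0: "0 \<le> z i" if "i < N" for i using sx[OF that] that by (simp add: z_def w_def)
    have zi: "z i > 0" using z0[OF i] neq by (simp add: z_def)
    have N: "{..<N} \<noteq> {}" using i by auto
    have w0: "0 \<le> w i" for i
      unfolding w_def using x0 by (auto intro!: sum_nonneg mult_nonneg_nonneg less_imp_le[OF pos])
    have Az: "(\<Sum>j<N. A k j * z j) > 0" if "k < N" for k
      using i zi pos[OF that i]
      by (intro sum_pos2[where i = i])
        (auto intro!: mult_nonneg_nonneg z0 less_imp_le[OF pos] that)
    define \<eta> where "\<eta> = Min ((\<lambda>k. \<Sum>j<N. A k j * z j) ` {..<N})"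
    have \<eta>: "\<eta> > 0" unfolding \<eta>_def using N Az by (subst Min_gr_iff) auto
    have \<eta>k: "\<eta> \<le> (\<Sum>j<N. A k j * z j)" if "k < N" for k
      unfolding \<eta>_def using that by (intro Min_le) auto
    define W where "W = (\<Sum>i<N. w i)"
    have wW: "w k \<le> W" if "k < N" for k
      unfolding W_def using that w0 by (intro member_le_sum) auto
    have "w i > 0"
    proof -
      have "s * x i \<ge> 0" using \<open>\<delta> \<le> s\<close> \<delta>(1) x0 by simp
      then show ?thesis using zi by (simp add: z_def)
    qed
    then have W: "W > 0" using wW[OF i] by simp
    have "(s + \<eta> / W) \<in> \<Lambda>"
    proof -
      have "(\<lambda>i. w i / W) \<in> K"
        using w0 W by (auto simp: K_def w_def W_def sum_divide_distrib[symmetric])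
      moreover have "(s + \<eta> / W) * (w k / W) \<le> (\<Sum>j<N. A k j * (w j / W))" if k: "k < N" for k
      proof -
        have "(\<Sum>j<N. A k j * w j) = (\<Sum>j<N. A k j * z j) + s * w k"
        proof -
          have "(\<Sum>j<N. A k j * w j) = (\<Sum>j<N. A k j * z j + s * (A k j * x j))"
            by (intro sum.cong) (auto simp: z_def algebra_simps)
          then show ?thesis using k by (simp add: sum.distrib sum_distrib_left w_def)
        qed
        moreover have "\<eta> / W * w k \<le> \<eta> / W * W"
          by (intro mult_left_mono wW[OF k]) (use \<eta> W in auto)
        then have "\<eta> / W * w k \<le> \<eta>" using W by simp
        ultimately have "(s + \<eta> / W) * w k \<le> (\<Sum>j<N. A k j * w j)"
          using \<eta>k[OF k] by (simp add: algebra_simps)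
        then have "(s + \<eta> / W) * w k / W \<le> (\<Sum>j<N. A k j * w j) / W"
          by (rule divide_right_mono) (use W in simp)
        then show ?thesis by (simp add: sum_divide_distrib)
      qed
      ultimately show ?thesis
        unfolding \<Lambda>_def mem_Collect_eq by (intro bexI[of _ "\<lambda>i. w i / W"]) simp_all
    qed
    then have "s + \<eta> / W \<le> s" unfolding s_def by (rule cSup_upper[OF _ bddA])
    then show False using \<eta> W by (simp add: field_simps)
  qed
  then show ?thesis using that[of s x] \<open>\<delta> \<le> s\<close> x0 xN x1 by (simp add: w_def)
qed

text \<open>
  A theorem of Krein--Rutman type.  The indices \<open>0, \<dots>, p\<close> force Perron eigenvalues of at least \<open>\<delta>\<close>
  on the finite sections, while the last assumption says that in the \<open>\<ell>\<^sub>1\<close>-norm weighted by \<open>u\<close>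
  the compression of \<open>S\<close> to the coordinates from \<open>R\<close> on has norm at most \<open>\<delta>/2\<close>, and that
  little mass enters them from below \<open>R\<close>.  For a normalized eigenvector with eigenvalue \<open>\<mu> \<ge> \<delta>\<close> the
  weighted tail \<open>Z\<close> from \<open>R\<close> on satisfies \<open>\<delta> Z \<le> \<mu> Z \<le> (\<delta>/2) Z + \<epsilon>\<close>, so the tails are uniformly
  small and the eigenvectors of the sections have a nonzero limit point.
\<close>

theorem positive_eigenvectorI:
  fixes S :: ell1_op and u :: "nat \<Rightarrow> real"
  assumes nonneg: "\<And>i j. 0 \<le> entry S i j"
    and u: "\<And>i. 1 \<le> u i" "\<And>i. u i \<le> U"
    and \<delta>: "0 < \<delta>" "\<And>i. i \<le> p \<Longrightarrow> \<delta> \<le> (\<Sum>j\<le>p. entry S i j)"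
    and tail: "\<And>\<epsilon>. \<epsilon> > 0 \<Longrightarrow> \<exists>R. (\<forall>j\<ge>R. \<forall>N. (\<Sum>i=R..<N. u i * entry S i j) \<le> \<delta> / 2 * u j) \<and>
                    (\<forall>j<R. \<forall>N. (\<Sum>i=R..<N. u i * entry S i j) \<le> \<epsilon>)"
  shows "has_positive_eigenvector S"
proof -
  \<comment> \<open>Adding \<open>\<eta> N\<close> to all entries makes the \<open>N \<times> N\<close> section strictly positive, while the
    norm of the perturbation, \<open>N * \<eta> N\<close>, still tends to \<open>0\<close>.\<close>
  define \<eta> where "\<eta> N = 1 / (real (N + 1))\<^sup>2" for N
  have \<eta>: "\<eta> N > 0" "real N * \<eta> N \<le> 1 / (real (N + 1))" "\<eta> N \<le> 1" for N
    unfolding \<eta>_def power2_eq_square by (auto simp: divide_simps mult_ge1_I)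
  have "\<exists>x \<mu>. \<delta> \<le> \<mu> \<and> (\<forall>i. 0 \<le> x i) \<and> (\<forall>i\<ge>N. x i = 0) \<and> (\<Sum>i<N. x i) = 1 \<and>
      (\<forall>i<N. (\<Sum>j<N. (entry S i j + \<eta> N) * x j) = \<mu> * x i)" if N: "N > p" for N
  proof -
    \<comment> \<open>The uniform distribution on \<open>0, \<dots>, p\<close> witnesses the lower bound \<open>\<delta>\<close>.\<close>
    define y where "y i = (if i \<le> p then 1 / real (p + 1) else 0)" for i
    have sub: "(\<Sum>i<N. g i * y i) = (\<Sum>i\<le>p. g i) / real (p + 1)" for g
    proof -
      have "(\<Sum>i<N. g i * y i) = (\<Sum>i\<in>{..p}. g i * y i)"
        using N by (intro sum.mono_neutral_right) (auto simp: y_def)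
      then show ?thesis by (simp add: y_def sum_divide_distrib)
    qed
    have ys: "(\<Sum>i<N. y i) = 1" using sub[of "\<lambda>_. 1"] by simp
    have "\<delta> * y i \<le> (\<Sum>j<N. (entry S i j + \<eta> N) * y j)" for i
    proof (cases "i \<le> p")
      case True
      have "\<delta> \<le> (\<Sum>j\<le>p. entry S i j + \<eta> N)"
        using \<delta>(2)[OF True] sum_mono[of "{..p}" "entry S i" "\<lambda>j. entry S i j + \<eta> N"] \<eta>(1)[of N]
        by force
      then show ?thesis
        using True unfolding sub by (simp add: y_def divide_right_mono del: sum_constant)
    next
      case False
      have "0 \<le> (\<Sum>j\<le>p. entry S i j + \<eta> N)"
        using nonneg \<eta>(1)[of N] by (intro sum_nonneg add_nonneg_nonneg) auto
      then show ?thesis using False unfolding sub by (simp add: y_def)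
    qed
    moreover have "entry S i j + \<eta> N > 0" for i j
      using nonneg[of i j] \<eta>(1)[of N] by simp
    moreover have "0 \<le> y i" for i by (simp add: y_def)
    ultimately show ?thesis
      using positive_matrix_eigenvector[of N "\<lambda>i j. entry S i j + \<eta> N" y \<delta>] ys \<delta>(1)
      by (smt (verit, ccfv_threshold))
  qed
  note section_eigenvector = this
  define N where "N n = Suc (p + n)" for n
  define is_eig where "is_eig n x \<mu> \<longleftrightarrow> \<delta> \<le> \<mu> \<and> (\<forall>i. 0 \<le> x i) \<and> (\<forall>i\<ge>N n. x i = 0) \<and>
      (\<Sum>i<N n. x i) = 1 \<and> (\<forall>i<N n. (\<Sum>j<N n. (entry S i j + \<eta> (N n)) * x j) = \<mu> * x i)"
    for n x \<mu>
  have "\<exists>x \<mu>. is_eig n x \<mu>" for n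
    unfolding is_eig_def by (rule section_eigenvector) (simp add: N_def)
  then obtain \<xi> \<mu> where "\<And>n. is_eig n (\<xi> n) (\<mu> n)" by metis
  then have \<mu>: "\<And>n. \<delta> \<le> \<mu> n"
    and \<xi>: "\<And>n i. 0 \<le> \<xi> n i" "\<And>n i. N n \<le> i \<Longrightarrow> \<xi> n i = 0" "\<And>n. (\<Sum>i<N n. \<xi> n i) = 1"
    and eig: "\<And>n i. i < N n \<Longrightarrow> (\<Sum>j<N n. (entry S i j + \<eta> (N n)) * \<xi> n j) = \<mu> n * \<xi> n i"
    unfolding is_eig_def by blast+
  define X where "X n = Abs_ell1 (\<xi> n)" for n
  have cX: "coord (X n) = \<xi> n" for n
  proof -
    have "summable (\<lambda>i. \<bar>\<xi> n i\<bar>)"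
      by (rule summable_finite[of "{..<N n}"]) (use \<xi>(2) in auto)
    then show ?thesis by (simp add: X_def Abs_ell1_inverse)
  qed
  have normX: "norm (X n) = 1" for n
  proof -
    have "norm (X n) = (\<Sum>i<N n. \<bar>coord (X n) i\<bar>)"
      unfolding norm_ell1_def by (rule suminf_finite) (use \<xi>(2) in \<open>auto simp: cX\<close>)
    then show ?thesis using \<xi>(1,3) by (simp add: cX)
  qed
  have SX: "coord (S (X n)) i + \<eta> (N n) = \<mu> n * \<xi> n i" if "i < N n" for n i
  proof -
    have "coord (S (X n)) i = (\<Sum>j<N n. entry S i j * \<xi> n j)"
      using coord_blinfun_finite_support[of "N n" "X n" S i] \<xi>(2) by (simp add: cX)
    then show ?thesis using eig[OF that] \<xi>(3)[of n]
      by (simp add: algebra_simps sum.distrib sum_distrib_left[symmetric])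
  qed
  have \<mu>_le: "\<mu> n \<le> norm S + 1" for n
  proof -
    have "\<mu> n = (\<Sum>i<N n. \<mu> n * \<xi> n i)" using \<xi>(3) by (simp add: sum_distrib_left[symmetric])
    also have "\<dots> = (\<Sum>i<N n. coord (S (X n)) i + \<eta> (N n))"
      using SX by (intro sum.cong) auto
    also have "\<dots> = (\<Sum>i<N n. coord (S (X n)) i) + real (N n) * \<eta> (N n)"
      by (simp add: sum.distrib)
    also have "(\<Sum>i<N n. coord (S (X n)) i) \<le> (\<Sum>i<N n. \<bar>coord (S (X n)) i\<bar>)"
      by (rule sum_mono) simp
    also have "\<dots> \<le> norm (S (X n))" by (rule sum_le_norm_ell1) simp
    also have "\<dots> \<le> norm S" using norm_blinfun[of S "X n"] by (simp add: normX)
    also have "real (N n) * \<eta> (N n) \<le> 1"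
      using \<eta>(2)[of "N n"] by (rule order_trans) simp
    finally show ?thesis by simp
  qed
  have key: "\<exists>R. \<forall>\<^sub>F n in sequentially. \<forall>M. (\<Sum>i=R..<M. \<bar>coord (X n) i\<bar>) \<le> \<epsilon>" if "\<epsilon> > 0" for \<epsilon>
  proof -
    \<comment> \<open>The tail will be bounded by \<open>2 / \<delta> * \<epsilon>'\<close>, which is \<open>\<epsilon> / 2\<close>, up to a term
      that tends to \<open>0\<close>.\<close>
    define \<epsilon>' where "\<epsilon>' = \<epsilon> * \<delta> / 4"
    have "\<epsilon>' > 0" using that \<delta>(1) by (simp add: \<epsilon>'_def)
    then obtain R where R1: "\<And>j M. j \<ge> R \<Longrightarrow> (\<Sum>i=R..<M. u i * entry S i j) \<le> \<delta> / 2 * u j"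
      and R2: "\<And>j M. j < R \<Longrightarrow> (\<Sum>i=R..<M. u i * entry S i j) \<le> \<epsilon>'"
      using tail by meson
    have bound: "(\<Sum>i=R..<M. \<bar>coord (X n) i\<bar>) \<le> 2 / \<delta> * (\<epsilon>' + U / real (N n + 1))" for n M
    proof -
      define Z where "Z = (\<Sum>i=R..<N n. u i * \<xi> n i)"
      have "(\<Sum>i=R..<N n. u i * (\<mu> n * \<xi> n i))
          = (\<Sum>i=R..<N n. u i * ((\<Sum>j<N n. entry S i j * \<xi> n j) + \<eta> (N n)))"
        using coord_blinfun_finite_support[of "N n" "X n" S] \<xi>(2) SX[of _ n]
        by (intro sum.cong) (auto simp: cX)
      also have "\<dots> = (\<Sum>i=R..<N n. \<Sum>j<N n. u i * (entry S i j * \<xi> n j)) + (\<Sum>i=R..<N n. u i * \<eta> (N n))"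
        by (simp add: distrib_left sum.distrib sum_distrib_left)
      also have "(\<Sum>i=R..<N n. \<Sum>j<N n. u i * (entry S i j * \<xi> n j))
          = (\<Sum>j<N n. \<xi> n j * (\<Sum>i=R..<N n. u i * entry S i j))"
        by (subst sum.swap) (simp add: sum_distrib_left mult_ac)
      also have "\<dots> \<le> (\<Sum>j<N n. \<epsilon>' * \<xi> n j + (if j \<in> {R..<N n} then \<delta> / 2 * (u j * \<xi> n j) else 0))"
      proof (rule sum_mono)
        fix j assume "j \<in> {..<N n}"
        then show "\<xi> n j * (\<Sum>i=R..<N n. u i * entry S i j)
            \<le> \<epsilon>' * \<xi> n j + (if j \<in> {R..<N n} then \<delta> / 2 * (u j * \<xi> n j) else 0)"
          using mult_left_mono[OF R1[of j "N n"] \<xi>(1)[of n j]]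
            mult_left_mono[OF R2[of j "N n"] \<xi>(1)[of n j]]
            mult_nonneg_nonneg[OF less_imp_le[OF \<open>\<epsilon>' > 0\<close>] \<xi>(1)[of n j]]
          by (cases "j < R") (auto simp: mult_ac)
      qed
      also have "\<dots> = \<epsilon>' + (\<Sum>j<N n. if j \<in> {R..<N n} then \<delta> / 2 * (u j * \<xi> n j) else 0)"
        using \<xi>(3)[of n] by (simp add: sum.distrib sum_distrib_left[symmetric])
      also have "(\<Sum>j<N n. if j \<in> {R..<N n} then \<delta> / 2 * (u j * \<xi> n j) else 0) = \<delta> / 2 * Z"
        unfolding Z_def sum_distrib_left by (subst sum.inter_restrict[symmetric]) (auto intro: sum.cong)
      also have "(\<Sum>i=R..<N n. u i * \<eta> (N n)) \<le> (\<Sum>i=R..<N n. U * \<eta> (N n))"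
        by (intro sum_mono mult_right_mono u) (use \<eta>(1) in \<open>simp add: less_imp_le\<close>)
      also have "\<dots> \<le> U * (real (N n) * \<eta> (N n))"
      proof -
        have "0 \<le> U" using u[of 0] by simp
        then show ?thesis using \<eta>(1)[of "N n"] by (simp add: mult_left_mono mult_ac)
      qed
      also have "\<dots> \<le> U / real (N n + 1)"
        using mult_left_mono[OF \<eta>(2)[of "N n"], of U] u[of 0] by simp
      finally have "(\<Sum>i=R..<N n. u i * (\<mu> n * \<xi> n i)) \<le> \<epsilon>' + \<delta> / 2 * Z + U / real (N n + 1)"
        by simp
      moreover have "(\<Sum>i=R..<N n. u i * (\<mu> n * \<xi> n i)) = \<mu> n * Z"
        by (simp add: Z_def sum_distrib_left mult_ac)
      moreover have Z0: "0 \<le> Z" unfolding Z_def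
        using \<xi>(1) u(1) by (intro sum_nonneg mult_nonneg_nonneg) (auto intro: order_trans[OF zero_le_one])
      then have "\<delta> * Z \<le> \<mu> n * Z" using \<mu>[of n] by (intro mult_right_mono)
      ultimately have "\<delta> / 2 * Z \<le> \<epsilon>' + U / real (N n + 1)" by linarith
      then have "2 / \<delta> * (\<delta> / 2 * Z) \<le> 2 / \<delta> * (\<epsilon>' + U / real (N n + 1))"
        by (rule mult_left_mono) (use \<delta>(1) in simp)
      then have "Z \<le> 2 / \<delta> * (\<epsilon>' + U / real (N n + 1))"
        using \<delta>(1) by simp
      moreover have "(\<Sum>i=R..<M. \<bar>coord (X n) i\<bar>) \<le> Z"
      proof -
        have "(\<Sum>i=R..<M. \<bar>coord (X n) i\<bar>) = (\<Sum>i=R..<min M (N n). \<bar>coord (X n) i\<bar>)"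
          by (rule sum.mono_neutral_right) (use \<xi>(2) in \<open>auto simp: cX\<close>)
        also have "\<dots> \<le> (\<Sum>i=R..<N n. \<bar>coord (X n) i\<bar>)"
          by (rule sum_mono2) auto
        also have "\<dots> \<le> Z" unfolding Z_def
        proof (rule sum_mono)
          fix i
          show "\<bar>coord (X n) i\<bar> \<le> u i * \<xi> n i"
            using mult_right_mono[OF u(1)[of i] \<xi>(1)[of n i]] \<xi>(1)[of n i] by (simp add: cX)
        qed
        finally show ?thesis .
      qed
      ultimately show ?thesis by simp
    qed
    have "(\<lambda>n. 2 / \<delta> * (\<epsilon>' + U / real (N n + 1))) \<longlonglongrightarrow> 2 / \<delta> * (\<epsilon>' + 0)"
      unfolding N_def by (intro tendsto_intros) real_asymp
    moreover have "2 / \<delta> * (\<epsilon>' + 0) < \<epsilon>" using \<delta>(1) that by (simp add: \<epsilon>'_def)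
    ultimately have "\<forall>\<^sub>F n in sequentially. 2 / \<delta> * (\<epsilon>' + U / real (N n + 1)) < \<epsilon>"
      by (rule order_tendstoD(2))
    then have "\<forall>\<^sub>F n in sequentially. \<forall>M. (\<Sum>i=R..<M. \<bar>coord (X n) i\<bar>) \<le> \<epsilon>"
      by eventually_elim (use bound order_trans less_imp_le in blast)
    then show ?thesis by blast
  qed
  obtain x r where r: "strict_mono (r :: nat \<Rightarrow> nat)" and x: "(\<lambda>n. X (r n)) \<longlonglongrightarrow> x"
    using ell1_convergent_subsequence[of X 1, OF eq_refl[OF normX] key] by blast
  have "\<bar>\<mu> n\<bar> \<le> norm S + 1" for n using \<mu>_le[of n] \<mu>[of n] \<delta>(1) by simp
  then obtain c r' where r': "strict_mono (r' :: nat \<Rightarrow> nat)" and c: "(\<lambda>n. \<mu> (r (r' n))) \<longlonglongrightarrow> c"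
    using coordinatewise_convergent_subsequence[of "\<lambda>n _. \<mu> (r n)" "norm S + 1"] by blast
  define q where "q = r \<circ> r'"
  have q: "strict_mono q" unfolding q_def using r r' by (rule strict_mono_o)
  have Xq: "(\<lambda>n. X (q n)) \<longlonglongrightarrow> x"
    using LIMSEQ_subseq_LIMSEQ[OF x r'] by (simp add: q_def o_def)
  have cq: "(\<lambda>n. \<mu> (q n)) \<longlonglongrightarrow> c" using c by (simp add: q_def)
  have xi: "(\<lambda>n. \<xi> (q n) i) \<longlonglongrightarrow> coord x i" for i
    using tendsto_coord[OF Xq, of i] by (simp add: cX)
  have "norm x = 1"
    using tendsto_norm[OF Xq] by (simp add: normX LIMSEQ_const_iff)
  then have "x \<noteq> 0" by auto
  moreover have "0 \<le> x"
    unfolding less_eq_ell1_def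
  proof
    fix i
    show "coord 0 i \<le> coord x i"
      using LIMSEQ_le_const[OF xi, of 0 i] \<xi>(1) by simp
  qed
  moreover have "S x = c *\<^sub>R x"
  proof (rule ell1_eqI)
    fix i
    have lim: "(\<lambda>n. coord (S (X (q n))) i + \<eta> (N (q n))) \<longlonglongrightarrow> coord (S x) i + 0"
    proof (intro tendsto_add)
      show "(\<lambda>n. coord (S (X (q n))) i) \<longlonglongrightarrow> coord (S x) i"
        by (intro tendsto_coord blinfun.tendsto tendsto_const Xq)
      have "(\<lambda>n. \<eta> (N n)) \<longlonglongrightarrow> 0" unfolding \<eta>_def N_def by real_asymp
      from LIMSEQ_subseq_LIMSEQ[OF this q] show "(\<lambda>n. \<eta> (N (q n))) \<longlonglongrightarrow> 0" by (simp add: o_def)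
    qed
    have lim': "(\<lambda>n. \<mu> (q n) * \<xi> (q n) i) \<longlonglongrightarrow> c * coord x i"
      by (intro tendsto_mult cq xi)
    have "\<forall>\<^sub>F n in sequentially. coord (S (X (q n))) i + \<eta> (N (q n)) = \<mu> (q n) * \<xi> (q n) i"
    proof -
      have "i < N (q n)" if "n \<ge> i" for n
        using seq_suble[OF q, of n] that by (simp add: N_def)
      then show ?thesis using SX unfolding eventually_sequentially by blast
    qed
    from LIMSEQ_unique[OF Lim_transform_eventually[OF lim this] lim']
    show "coord (S x) i = coord (c *\<^sub>R x) i" by simp
  qed
  ultimately show ?thesis unfolding has_positive_eigenvector_def by blast
qed

section \<open>The vectors of Read's construction\<close>

text \<open>
  The solution of \<open>f\<^sub>i = \<alpha>\<^sub>i e\<^sub>i - \<gamma>\<^sub>i e\<^bsub>p(i)\<^esub>\<close> by recursion on \<open>i\<close>.  The test \<open>p i < i\<close> is there to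
  guarantee termination; it fails only for \<open>i = 0\<close> in the application, where \<open>\<gamma> 0 = 0\<close>.
\<close>

function triangular_solution :: "(nat \<Rightarrow> real) \<Rightarrow> (nat \<Rightarrow> real) \<Rightarrow> (nat \<Rightarrow> nat) \<Rightarrow> nat \<Rightarrow> ell1" where
  "triangular_solution \<alpha> \<gamma> p i = (1 / \<alpha> i) *\<^sub>R
     (unit_vec i + \<gamma> i *\<^sub>R (if p i < i then triangular_solution \<alpha> \<gamma> p (p i) else 0))"
  by pat_completeness auto
termination by (relation "Wellfounded.measure (\<lambda>(\<alpha>, \<gamma>, p, i). i)") auto

declare triangular_solution.simps [simp del]

text \<open>
  These two growth conditions keep the index intervals of the construction disjoint, and those of
  the clauses B and D nonempty.
\<close>

locale read_sequence =
  fixes d :: "nat \<Rightarrow> nat"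
  assumes a_large: "1 \<le> n \<Longrightarrow> seq_v d (n - 1) + 2 \<le> seq_a d n"
    and b_large: "1 \<le> n \<Longrightarrow> n * seq_a d n + 2 \<le> seq_b d n"
begin

abbreviation "a \<equiv> seq_a d"
abbreviation "b \<equiv> seq_b d"
abbreviation "v \<equiv> seq_v d"

lemma a_0: "a 0 = 1" and v_0: "v 0 = 0"
  by (simp_all add: seq_a_def seq_v_def)

lemma v_eq: "1 \<le> n \<Longrightarrow> v n = n * a n + n * b n"
  by (simp add: seq_v_def algebra_simps)

lemma a_pos: "0 < a n"
  using a_large[of n] by (cases "n = 0") (auto simp: a_0)

lemma na_less_v: "1 \<le> n \<Longrightarrow> n * a n < v n"
  using b_large[of n] by (simp add: v_eq)

lemma v_less_a: "1 \<le> n \<Longrightarrow> v (n - 1) < a n"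
  using a_large[of n] by simp

lemma a_le_na: "1 \<le> n \<Longrightarrow> a n \<le> n * a n"
  by simp

lemma strict_mono_v: "strict_mono v"
proof (rule strict_monoI_Suc)
  fix n show "v n < v (Suc n)"
    using v_less_a[of "Suc n"] na_less_v[of "Suc n"] a_le_na[of "Suc n"]
    by (metis diff_Suc_1 le_add1 less_trans order_less_le_trans plus_1_eq_Suc)
qed

lemma v_mono: "m \<le> n \<Longrightarrow> v m \<le> v n"
  using strict_mono_v by (simp add: strict_mono_less_eq)

lemma v_diff_less_a: "1 \<le> r \<Longrightarrow> r \<le> n \<Longrightarrow> v (n - r) + 2 \<le> a n"
  using v_mono[OF diff_le_mono2[of 1 r n]] a_large[of n] by linarith

text \<open>
  The level of an index \<open>i > 0\<close> is the \<open>n\<close> with \<open>v\<^bsub>n-1\<^esub> < i \<le> v\<^sub>n\<close>; the clauses that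
  may apply to \<open>i\<close> are those with this \<open>n\<close>.
\<close>

definition lev :: "nat \<Rightarrow> nat" where
  "lev i = (LEAST n. i \<le> v n)"

lemma lev_eqI: "1 \<le> n \<Longrightarrow> v (n - 1) < i \<Longrightarrow> i \<le> v n \<Longrightarrow> lev i = n"
  unfolding lev_def
proof (rule Least_equality)
  fix m assume *: "1 \<le> n" "v (n - 1) < i" "i \<le> v m"
  show "n \<le> m"
  proof (rule ccontr)
    assume "\<not> n \<le> m"
    then have "v m \<le> v (n - 1)" by (intro v_mono) simp
    then show False using * by simp
  qed
qed

lemma lev_bounds:
  assumes "0 < i"
  shows "1 \<le> lev i" "v (lev i - 1) < i" "i \<le> v (lev i)"
proof -
  have "i \<le> v i" using strict_mono_v by (rule strict_mono_imp_increasing)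
  then show i: "i \<le> v (lev i)" unfolding lev_def by (rule LeastI)
  show "1 \<le> lev i" using i assms v_0 by (cases "lev i = 0") auto
  then show "v (lev i - 1) < i"
    using not_less_Least[of "lev i - 1" "\<lambda>n. i \<le> v n"] unfolding lev_def by simp
qed

text \<open>
  The triple \<open>(\<alpha>\<^sub>i, \<gamma>\<^sub>i, p(i))\<close>.  Below \<open>n a\<^sub>n\<close>, division by \<open>a\<^sub>n\<close> tells the clauses A and B apart and
  finds \<open>r\<close>; above \<open>n a\<^sub>n\<close>, division by \<open>a\<^sub>n + b\<^sub>n\<close> does this for C and D.  A case distinction computed
  from \<open>i\<close> makes it immediate that the clauses do not conflict.
\<close>

definition coeffs :: "nat \<Rightarrow> real \<times> real \<times> nat" where
  "coeffs i =
    (let n = lev i; r = i div a n; s = i mod a n; r' = i div (a n + b n);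
         \<kappa> = real (n - r) ^ s * real (a (n - r))
     in if i = 0 then (1, 0, 0)
        else if i \<le> n * a n then
          (if 0 < r \<and> s \<le> v (n - r) then (real n ^ (r * a n) * \<kappa>, \<kappa>, s)
           else (real n ^ i * 2 powr (((real r + 1/2) * real (a n) - real i) / sqrt (real (a n))), 0, 0))
        else
          (if i \<le> n * a n + r' * b n then (real n ^ i, real (b n) * real n ^ (i - b n), i - b n)
           else (real n ^ i * 2 powr (((real r' + 1/2) * real (b n) - real i) / sqrt (real (b n))), 0, 0)))"

definition \<alpha> :: "nat \<Rightarrow> real" where "\<alpha> i = fst (coeffs i)"
definition \<gamma> :: "nat \<Rightarrow> real" where "\<gamma> i = fst (snd (coeffs i))"
definition pred_index :: "nat \<Rightarrow> nat" where "pred_index i = snd (snd (coeffs i))"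

lemma coeffs_0: "\<alpha> 0 = 1" "\<gamma> 0 = 0" "pred_index 0 = 0"
  by (simp_all add: \<alpha>_def \<gamma>_def pred_index_def coeffs_def)

lemma block_A_bounds:
  assumes "1 \<le> r" "r \<le> n" "s \<le> v (n - r)"
  shows "v (n - 1) < r * a n + s" "r * a n + s \<le> n * a n" "s < a n"
proof -
  show s: "s < a n" using v_diff_less_a[of r n] assms by simp
  have "a n \<le> r * a n" using assms(1) by simp
  then show "v (n - 1) < r * a n + s" using v_less_a[of n] assms by linarith
  show "r * a n + s \<le> n * a n"
  proof (cases "r = n")
    case True
    then show ?thesis using assms v_0 by simp
  next
    case False
    then have "Suc r * a n \<le> n * a n" using assms by (intro mult_right_mono) auto
    then show ?thesis using s by simp
  qed
qed

lemma coeffs_A: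
  assumes "1 \<le> r" "r \<le> n" "s \<le> v (n - r)"
  defines "i \<equiv> r * a n + s"
  shows "lev i = n" "i div a n = r" "i mod a n = s" "i \<le> n * a n"
    "\<alpha> i = real n ^ (r * a n) * (real (n - r) ^ s * real (a (n - r)))"
    "\<gamma> i = real (n - r) ^ s * real (a (n - r))" "pred_index i = s"
proof -
  note bounds = block_A_bounds[OF assms(1-3), folded i_def]
  show lev: "lev i = n"
    using assms bounds na_less_v[of n] by (intro lev_eqI) auto
  show div: "i div a n = r" and mod: "i mod a n = s" and le: "i \<le> n * a n"
    using bounds a_pos[of n] by (simp_all add: i_def)
  have "coeffs i = (real n ^ (r * a n) * (real (n - r) ^ s * real (a (n - r))),
      real (n - r) ^ s * real (a (n - r)), s)"
    using assms(1-3) bounds unfolding coeffs_def Let_def lev div mod by simp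
  then show "\<alpha> i = real n ^ (r * a n) * (real (n - r) ^ s * real (a (n - r)))"
    "\<gamma> i = real (n - r) ^ s * real (a (n - r))" "pred_index i = s"
    by (simp_all add: \<alpha>_def \<gamma>_def pred_index_def)
qed

lemma coeffs_B:
  assumes r: "r < n" and i: "(if r = 0 then v (n - 1) else r * a n + v (n - r)) < i" "i < (r + 1) * a n"
  shows "lev i = n" "i div a n = r" "i \<le> n * a n" "r \<noteq> 0 \<longrightarrow> v (n - r) < i mod a n"
    "\<alpha> i = real n ^ i * 2 powr (((real r + 1/2) * real (a n) - real i) / sqrt (real (a n)))"
    "\<gamma> i = 0" "pred_index i = 0"
proof -
  have n: "1 \<le> n" using r by simp
  have ra: "r * a n \<le> i" using i(1) by (cases "r = 0") auto
  have vi: "v (n - 1) < i"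
  proof (cases "r = 0")
    case False
    then have "a n \<le> r * a n" by simp
    then show ?thesis using v_less_a[OF n] ra by linarith
  qed (use i in simp)
  have "(r + 1) * a n \<le> n * a n" using r by (intro mult_right_mono) auto
  then show le: "i \<le> n * a n" using i(2) by simp
  show lev: "lev i = n" using le na_less_v[OF n] by (intro lev_eqI n vi) simp
  have i_eq: "i = r * a n + (i - r * a n)" "i - r * a n < a n" using ra i(2) by auto
  show div: "i div a n = r" using ra i(2) by (intro div_nat_eqI) (auto simp: mult.commute)
  have "i mod a n = i - r * a n" using div by (simp add: minus_div_mult_eq_mod[symmetric])
  then show mod: "r \<noteq> 0 \<longrightarrow> v (n - r) < i mod a n" using i(1) by auto
  have "coeffs i = (real n ^ i * 2 powr (((real r + 1/2) * real (a n) - real i) / sqrt (real (a n))), 0, 0)"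
    using le vi mod unfolding coeffs_def Let_def lev div by auto
  then show "\<alpha> i = real n ^ i * 2 powr (((real r + 1/2) * real (a n) - real i) / sqrt (real (a n)))"
    "\<gamma> i = 0" "pred_index i = 0"
    by (simp_all add: \<alpha>_def \<gamma>_def pred_index_def)
qed

lemma coeffs_C:
  assumes r: "1 \<le> r" "r \<le> n" and i: "r * (a n + b n) \<le> i" "i \<le> n * a n + r * b n"
  shows "lev i = n" "n * a n < i" "b n \<le> i"
    "\<alpha> i = real n ^ i" "\<gamma> i = real (b n) * real n ^ (i - b n)" "pred_index i = i - b n"
proof -
  have n: "1 \<le> n" using r by simp
  have ab: "a n + b n \<le> r * (a n + b n)" using r by simp
  show na: "n * a n < i" "b n \<le> i" using b_large[OF n] ab i(1) by linarith+
  have "r * b n \<le> n * b n" using r by (intro mult_right_mono) auto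
  then have "i \<le> v n" using i(2) v_eq[OF n] by linarith
  moreover have "v (n - 1) < i" using v_less_a[OF n] a_le_na[OF n] na by linarith
  ultimately show lev: "lev i = n" by (intro lev_eqI n)
  have "i < Suc r * (a n + b n)" using i(2) b_large[OF n] by (simp add: algebra_simps)
  then have div: "i div (a n + b n) = r"
    using i(1) by (intro div_nat_eqI) (auto simp: mult.commute)
  have "coeffs i = (real n ^ i, real (b n) * real n ^ (i - b n), i - b n)"
    using na i unfolding coeffs_def Let_def lev div by auto
  then show "\<alpha> i = real n ^ i" "\<gamma> i = real (b n) * real n ^ (i - b n)" "pred_index i = i - b n"
    by (simp_all add: \<alpha>_def \<gamma>_def pred_index_def)
qed

lemma coeffs_D:
  assumes r: "r < n" and i: "n * a n + r * b n < i" "i < (r + 1) * (a n + b n)"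
  shows "lev i = n" "n * a n < i"
    "\<alpha> i = real n ^ i * 2 powr (((real r + 1/2) * real (b n) - real i) / sqrt (real (b n)))"
    "\<gamma> i = 0" "pred_index i = 0"
proof -
  have n: "1 \<le> n" using r by simp
  show na: "n * a n < i" using i(1) by simp
  have "(r + 1) * (a n + b n) \<le> n * (a n + b n)" using r by (intro mult_right_mono) auto
  then have "i \<le> v n" using i(2) by (simp add: v_eq[OF n] algebra_simps)
  moreover have "v (n - 1) < i" using v_less_a[OF n] a_le_na[OF n] na by linarith
  ultimately show lev: "lev i = n" by (intro lev_eqI n)
  have "r * a n \<le> n * a n" using r by (intro mult_right_mono) auto
  then have "r * (a n + b n) \<le> i" using i(1) unfolding distrib_left by linarith
  then have div: "i div (a n + b n) = r"
    using i(2) by (intro div_nat_eqI) (auto simp: mult.commute)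
  have "coeffs i = (real n ^ i * 2 powr (((real r + 1/2) * real (b n) - real i) / sqrt (real (b n))), 0, 0)"
    using na i unfolding coeffs_def Let_def lev div by auto
  then show "\<alpha> i = real n ^ i * 2 powr (((real r + 1/2) * real (b n) - real i) / sqrt (real (b n)))"
    "\<gamma> i = 0" "pred_index i = 0"
    by (simp_all add: \<alpha>_def \<gamma>_def pred_index_def)
qed

lemma index_cases:
  obtains (zero) "i = 0"
  | (A) r n s where "1 \<le> r" "r \<le> n" "s \<le> v (n - r)" "i = r * a n + s"
  | (B) r n where "r < n" "(if r = 0 then v (n - 1) else r * a n + v (n - r)) < i" "i < (r + 1) * a n"
  | (C) r n where "1 \<le> r" "r \<le> n" "r * (a n + b n) \<le> i" "i \<le> n * a n + r * b n"
  | (D) r n where "r < n" "n * a n + r * b n < i" "i < (r + 1) * (a n + b n)"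
proof (cases "i = 0")
  case True
  then show ?thesis by (rule zero)
next
  case False
  define n where "n = lev i"
  have n: "1 \<le> n" "v (n - 1) < i" "i \<le> v n"
    using lev_bounds[of i] False by (simp_all add: n_def)
  show ?thesis
  proof (cases "i \<le> n * a n")
    case le: True
    define r s where "r = i div a n" and "s = i mod a n"
    have rs: "i = r * a n + s" "s < a n"
      using a_pos[of n] div_mult_mod_eq[of i "a n"] by (simp_all add: r_def s_def)
    have "r * a n \<le> n * a n" using rs le by linarith
    then have rn: "r \<le> n" using a_pos[of n] by simp
    show ?thesis
    proof (cases "1 \<le> r \<and> s \<le> v (n - r)")
      case True
      then show ?thesis using A rn rs by blast
    next
      case F: False
      have "r \<noteq> n"
      proof
        assume "r = n"
        then have "s = 0" using rs le by simp
        then show False using F \<open>r = n\<close> n by simp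
      qed
      then show ?thesis using F rs rn n by (intro B[of r n]) auto
    qed
  next
    case gt: False
    define r where "r = i div (a n + b n)"
    have r: "r * (a n + b n) \<le> i" "i < (r + 1) * (a n + b n)"
      using a_pos[of n] dividend_less_div_times[of "a n + b n" i]
      by (simp_all add: r_def mult.commute)
    have "r * (a n + b n) \<le> n * (a n + b n)" using r(1) n(3) by (simp add: v_eq[OF n(1)] algebra_simps)
    then have rn: "r \<le> n" using a_pos[of n] by simp
    show ?thesis
    proof (cases "i \<le> n * a n + r * b n")
      case True
      then have "1 \<le> r" using gt by (cases r) auto
      then show ?thesis using C rn r True by blast
    next
      case F: False
      have "r \<noteq> n" using F n(3) by (auto simp: v_eq[OF n(1)])
      then show ?thesis using F rn r by (intro D[of r n]) auto
    qed
  qed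
qed

lemma \<alpha>_pos: "0 < \<alpha> i"
proof (cases i rule: index_cases)
  case (A r n s)
  have "0 < real (n - r) ^ s" using A v_0 by (cases "r = n") auto
  then show ?thesis using A a_pos by (simp add: coeffs_A)
qed (auto simp: coeffs_0 coeffs_B(5) coeffs_C(4) coeffs_D(3))

lemma \<gamma>_nonneg: "0 \<le> \<gamma> i"
  by (cases i rule: index_cases) (simp_all add: coeffs_0 coeffs_A coeffs_B(6) coeffs_C(5) coeffs_D(4))

lemma pred_index_less: "0 < i \<Longrightarrow> pred_index i < i"
proof (cases i rule: index_cases)
  case (A r n s)
  then show ?thesis using a_pos[of n] by (simp add: coeffs_A)
next
  case (C r n)
  then show ?thesis using b_large[of n] by (simp add: coeffs_C(3,6)[OF C]) (use coeffs_C(2)[OF C] in simp)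
qed (simp_all add: coeffs_B(7) coeffs_D(5))

definition E :: "nat \<Rightarrow> ell1" where
  "E = triangular_solution \<alpha> \<gamma> pred_index"

lemma E_rec: "E i = (1 / \<alpha> i) *\<^sub>R (unit_vec i + \<gamma> i *\<^sub>R E (pred_index i))"
  using pred_index_less[of i] coeffs_0
  unfolding E_def by (subst triangular_solution.simps) auto

lemma unit_vec_eq_E: "unit_vec i = \<alpha> i *\<^sub>R E i - \<gamma> i *\<^sub>R E (pred_index i)"
  using \<alpha>_pos[of i] by (subst E_rec) simp

lemma triangular_unique:
  assumes "\<And>i. unit_vec i = \<alpha> i *\<^sub>R e i - \<gamma> i *\<^sub>R e (pred_index i)"
  shows "e = E"
proof
  fix i show "e i = E i"
  proof (induction i rule: less_induct)
    case (less i)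
    have "\<gamma> i *\<^sub>R e (pred_index i) = \<gamma> i *\<^sub>R E (pred_index i)"
      using less pred_index_less[of i] coeffs_0 by (cases "i = 0") auto
    then have "\<alpha> i *\<^sub>R e i = \<alpha> i *\<^sub>R E i"
      using assms[of i] unit_vec_eq_E[of i] by (metis diff_add_cancel)
    then show ?case using \<alpha>_pos[of i] by simp
  qed
qed

lemma E_nonneg: "0 \<le> coord (E i) j"
proof (induction i rule: less_induct)
  case (less i)
  then have "0 \<le> \<gamma> i * coord (E (pred_index i)) j"
    using pred_index_less[of i] coeffs_0 \<gamma>_nonneg[of i] by (cases "i = 0") auto
  then show ?case using \<alpha>_pos[of i] by (subst E_rec) (simp add: coord_unit_vec)
qed

lemma E_support: "i < j \<Longrightarrow> coord (E i) j = 0"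
proof (induction i rule: less_induct)
  case (less i)
  then have "\<gamma> i * coord (E (pred_index i)) j = 0"
    using pred_index_less[of i] coeffs_0 by (cases "i = 0") auto
  then show ?case using less.prems by (subst E_rec) (simp add: coord_unit_vec)
qed

lemma E_diagonal: "coord (E i) i = 1 / \<alpha> i"
  using E_support[of "pred_index i" i] pred_index_less[of i] coeffs_0
  by (subst E_rec) (cases "i = 0"; simp add: coord_unit_vec)

lemma E_in_span: "E i \<in> span (range unit_vec)"
proof (induction i rule: less_induct)
  case (less i)
  then have "\<gamma> i *\<^sub>R E (pred_index i) \<in> span (range unit_vec)"
    using pred_index_less[of i] coeffs_0 by (cases "i = 0") (auto intro: span_scale span_zero)
  then have "unit_vec i + \<gamma> i *\<^sub>R E (pred_index i) \<in> span (range unit_vec)"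
    by (intro span_add) (auto intro: span_base)
  then show ?case by (subst E_rec) (rule span_scale)
qed

text \<open>
  The intervals of the clauses exhaust the positive integers (\<open>index_cases\<close>), and in each of them
  the clause says exactly \<open>f\<^sub>i = \<alpha>\<^sub>i e\<^sub>i - \<gamma>\<^sub>i e\<^bsub>p(i)\<^esub>\<close>.
\<close>

lemma read_vectors_iff: "read_vectors d e \<longleftrightarrow> e = E"
proof
  assume "read_vectors d e"
  note e = this[unfolded read_vectors_def Let_def, THEN conjunct2]
  note e0 = e[THEN conjunct1] and eA = e[THEN conjunct2, THEN conjunct1, rule_format]
    and eB = e[THEN conjunct2, THEN conjunct2, THEN conjunct1, rule_format]
  note e' = e[THEN conjunct2, THEN conjunct2, THEN conjunct2]
  note eB0 = e'[THEN conjunct1, rule_format] and eC = e'[THEN conjunct2, THEN conjunct1, rule_format]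
    and eD = e'[THEN conjunct2, THEN conjunct2, rule_format]
  show "e = E"
  proof (rule triangular_unique)
    fix i
    show "unit_vec i = \<alpha> i *\<^sub>R e i - \<gamma> i *\<^sub>R e (pred_index i)"
    proof (cases i rule: index_cases)
      case zero
      then show ?thesis using e0 by (simp add: coeffs_0)
    next
      case (A r n s)
      then have "0 < r \<and> r \<le> n \<and> i \<in> {r * a n..v (n - r) + r * a n}" by simp
      then have "unit_vec i = (real (n - r) ^ (i - r * a n) * real (a (n - r))) *\<^sub>R
          (real n ^ (r * a n) *\<^sub>R e i - e (i - r * a n))"
        by (rule eA)
      then show ?thesis using A(4) by (simp add: coeffs_A[OF A(1-3)] scaleR_right_diff_distrib mult_ac)
    next
      case (B r n)
      have "unit_vec i = (real n ^ i *
         2 powr (((real r + 1/2) * real (a n) - real i) / sqrt (real (a n)))) *\<^sub>R e i"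
      proof (cases "r = 0")
        case True
        then have "1 \<le> n \<and> i \<in> {v (n - 1)<..<a n}" using B by simp
        from eB0[OF this] show ?thesis using True by simp
      next
        case False
        then have "0 < r \<and> r < n \<and> i \<in> {r * a n + v (n - r)<..<(r + 1) * a n}" using B by simp
        then show ?thesis by (rule eB)
      qed
      then show ?thesis by (simp add: coeffs_B(5,6)[OF B])
    next
      case (C r n)
      then have "0 < r \<and> r \<le> n \<and> i \<in> {r * (a n + b n)..n * a n + r * b n}" by simp
      then have "unit_vec i = real n ^ i *\<^sub>R e i - (real (b n) * real n ^ (i - b n)) *\<^sub>R e (i - b n)"
        by (rule eC)
      then show ?thesis by (simp add: coeffs_C(4-6)[OF C])
    next
      case (D r n)
      then have "r < n \<and> i \<in> {n * a n + r * b n<..<(r + 1) * (a n + b n)}" by simp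
      then have "unit_vec i = (real n ^ i *
         2 powr (((real r + 1/2) * real (b n) - real i) / sqrt (real (b n)))) *\<^sub>R e i"
        by (rule eD)
      then show ?thesis by (simp add: coeffs_D(3,4)[OF D])
    qed
  qed
next
  assume e: "e = E"
  show "read_vectors d e"
    unfolding read_vectors_def Let_def e
  proof (intro conjI allI impI)
    show "E i \<in> span (range unit_vec)" for i by (rule E_in_span)
    show "unit_vec 0 = E 0" using unit_vec_eq_E[of 0] by (simp add: coeffs_0)
  next
    fix r n i assume *: "0 < r \<and> r \<le> n \<and> i \<in> {r * a n..v (n - r) + r * a n}"
    define s where "s = i - r * a n"
    have s: "1 \<le> r" "r \<le> n" "s \<le> v (n - r)" and i: "i = r * a n + s" using * by (auto simp: s_def)
    show "unit_vec i = (real (n - r) ^ (i - r * a n) * real (a (n - r))) *\<^sub>R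
              (real n ^ (r * a n) *\<^sub>R E i - E (i - r * a n))"
      using unit_vec_eq_E[of i] unfolding i
      by (simp add: coeffs_A[OF s] scaleR_right_diff_distrib mult_ac)
  next
    fix r n i assume *: "0 < r \<and> r < n \<and> i \<in> {r * a n + v (n - r)<..<(r + 1) * a n}"
    then have "r < n" "(if r = 0 then v (n - 1) else r * a n + v (n - r)) < i" "i < (r + 1) * a n" by auto
    from coeffs_B(5,6)[OF this]
    show "unit_vec i = (real n ^ i *
       2 powr (((real r + 1/2) * real (a n) - real i) / sqrt (real (a n)))) *\<^sub>R E i"
      using unit_vec_eq_E[of i] by simp
  next
    fix n i assume *: "1 \<le> n \<and> i \<in> {v (n - 1)<..<a n}"
    then have "0 < n" "(if 0 = (0::nat) then v (n - 1) else 0 * a n + v (n - 0)) < i" "i < (0 + 1) * a n" by auto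
    from coeffs_B(5,6)[OF this]
    show "unit_vec i = (real n ^ i *
       2 powr ((1/2 * real (a n) - real i) / sqrt (real (a n)))) *\<^sub>R E i"
      using unit_vec_eq_E[of i] by simp
  next
    fix r n i assume *: "0 < r \<and> r \<le> n \<and> i \<in> {r * (a n + b n)..n * a n + r * b n}"
    then have "1 \<le> r" "r \<le> n" "r * (a n + b n) \<le> i" "i \<le> n * a n + r * b n" by auto
    from coeffs_C(4-6)[OF this]
    show "unit_vec i = real n ^ i *\<^sub>R E i - (real (b n) * real n ^ (i - b n)) *\<^sub>R E (i - b n)"
      using unit_vec_eq_E[of i] by simp
  next
    fix r n i assume *: "r < n \<and> i \<in> {n * a n + r * b n<..<(r + 1) * (a n + b n)}"
    then have "r < n" "n * a n + r * b n < i" "i < (r + 1) * (a n + b n)" by auto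
    from coeffs_D(3,4)[OF this]
    show "unit_vec i = (real n ^ i *
       2 powr (((real r + 1/2) * real (b n) - real i) / sqrt (real (b n)))) *\<^sub>R E i"
      using unit_vec_eq_E[of i] by simp
  qed
qed

lemma read_vec_eq: "read_vec d = E"
  unfolding read_vec_def read_vectors_iff by simp

text \<open>The vectors \<open>T f\<^sub>j\<close>, as dictated by \<open>T e\<^sub>i = e\<^bsub>i+1\<^esub>\<close>.\<close>

definition column :: "nat \<Rightarrow> ell1" where
  "column j = \<alpha> j *\<^sub>R E (Suc j) - \<gamma> j *\<^sub>R E (Suc (pred_index j))"

text \<open>
  The \<open>e\<^sub>i\<close> and the \<open>f\<^sub>j\<close> are bases of the same space, related by a triangular matrix.
\<close>

lemma shift_iff_columns:
  fixes S :: ell1_op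
  shows "(\<forall>i. S (E i) = E (Suc i)) \<longleftrightarrow> (\<forall>j. S (unit_vec j) = column j)"
proof safe
  fix j assume "\<forall>i. S (E i) = E (Suc i)"
  then show "S (unit_vec j) = column j"
    by (simp add: unit_vec_eq_E[of j] column_def blinfun.diff_right blinfun.scaleR_right)
next
  fix i assume S: "\<forall>j. S (unit_vec j) = column j"
  show "S (E i) = E (Suc i)"
  proof (induction i rule: less_induct)
    case (less i)
    have "\<gamma> i *\<^sub>R S (E (pred_index i)) = \<gamma> i *\<^sub>R E (Suc (pred_index i))"
      using less pred_index_less[of i] coeffs_0 by (cases "i = 0") auto
    then have "S (E i) = (1 / \<alpha> i) *\<^sub>R (column i + \<gamma> i *\<^sub>R E (Suc (pred_index i)))"
      by (subst E_rec) (simp add: blinfun.add_right blinfun.scaleR_right S)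
    then show ?case using \<alpha>_pos[of i] by (simp add: column_def)
  qed
qed

lemma read_operator_columns:
  assumes "\<And>j. norm (column j) \<le> K"
  shows "read_operator d (unit_vec j) = column j"
proof -
  obtain S :: ell1_op where S: "\<And>j. S (unit_vec j) = column j"
    by (rule blinfun_with_columns[where c = column and C = K, OF assms]) blast
  have "read_operator d = S"
    unfolding read_operator_def read_vec_eq shift_iff_columns
  proof (rule the_equality)
    show "\<forall>j. S (unit_vec j) = column j" by (simp add: S)
    show "S' = S" if "\<forall>j. S' (unit_vec j) = column j" for S' :: ell1_op
      by (rule blinfun_eqI_unit_vec) (simp add: S that)
  qed
  then show ?thesis by (simp add: S)
qed

lemma column_subdiagonal: "coord (column j) (Suc j) = \<alpha> j / \<alpha> (Suc j)"
proof -
  have "\<gamma> j * coord (E (Suc (pred_index j))) (Suc j) = 0"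
    using pred_index_less[of j] coeffs_0 E_support by (cases "j = 0") auto
  then show ?thesis by (simp add: column_def E_diagonal)
qed

lemma column_support: "Suc j < i \<Longrightarrow> coord (column j) i = 0"
  using pred_index_less[of j] coeffs_0
  by (cases "j = 0") (auto simp: column_def E_support)

end

section \<open>The columns of Read's operator\<close>

text \<open>
  The two exponentials are the reciprocals of the factors \<open>2\<^sup>x\<close>, \<open>x = (h-i)/\<surd>a\<^sub>n\<close> or
  \<open>x = (h-i)/\<surd>b\<^sub>n\<close>, at the first index \<open>i\<close> of the initial interval of clause B, respectively of any
  interval of clause D.  With the earlier terms fixed, they decay faster than any power of
  \<open>a\<^sub>n\<close>, respectively \<open>b\<^sub>n\<close>.
\<close>

locale rapid_read_sequence = read_sequence +
  assumes a_rapid: "1 \<le> n \<Longrightarrow> 2 * real (seq_a d (n - 1)) *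
      2 powr (- (real (seq_a d n) / 2 - real (seq_v d (n - 1)) - 1) / sqrt (real (seq_a d n))) \<le> 1 / real n"
    and b_rapid: "1 \<le> n \<Longrightarrow> real (n + 3) * real (seq_b d n) ^ (n + 1) *
      2 powr (- (real (seq_b d n) / 2 - real (n * seq_a d n) - 1) / sqrt (real (seq_b d n))) \<le> 1 / real n"
begin

definition \<theta>a :: "nat \<Rightarrow> real" where
  "\<theta>a n = 2 powr (- (real (a n) / 2 - real (v (n - 1)) - 1) / sqrt (real (a n)))"

definition \<theta>b :: "nat \<Rightarrow> real" where
  "\<theta>b n = 2 powr (- (real (b n) / 2 - real (n * a n) - 1) / sqrt (real (b n)))"

lemma \<theta>_pos: "0 < \<theta>a n" "0 < \<theta>b n"
  by (simp_all add: \<theta>a_def \<theta>b_def)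

lemma a_mono: "m \<le> n \<Longrightarrow> a m \<le> a n"
proof (induction n rule: dec_induct)
  case (step n)
  have "a n \<le> v n + 1"
  proof (cases "n = 0")
    case False
    then show ?thesis using v_eq[of n] a_le_na[of n] by linarith
  qed (simp add: a_0)
  then show ?case using step a_large[of "Suc n"] by simp
qed simp

lemma \<theta>a_bound:
  assumes "k < n"
  shows "2 * real (a k) * \<theta>a n \<le> 1 / real n"
proof -
  have "2 * real (a k) * \<theta>a n \<le> 2 * real (a (n - 1)) * \<theta>a n"
    using a_mono[of k "n - 1"] assms \<theta>_pos[of n] by (intro mult_right_mono) auto
  also have "\<dots> \<le> 1 / real n" using a_rapid[of n] assms by (simp add: \<theta>a_def)
  finally show ?thesis .
qed

lemma \<theta>a_le:
  assumes "1 \<le> n"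
  shows "2 * \<theta>a n \<le> 1 / real n"
  using \<theta>a_bound[of 0 n] assms a_0 by simp

lemma b_pos: "1 \<le> n \<Longrightarrow> 1 \<le> b n"
  using b_large[of n] by simp

lemma \<theta>b_bound: "1 \<le> n \<Longrightarrow> real (n + 3) * real (b n) ^ (n + 1) * \<theta>b n \<le> 1 / real n"
  using b_rapid[of n] by (simp add: \<theta>b_def)

lemma \<theta>b_bound':
  assumes "1 \<le> n" "x \<le> real (n + 3) * real (b n) ^ (n + 1)"
  shows "x * \<theta>b n \<le> 1 / real n"
proof -
  have "x * \<theta>b n \<le> (real (n + 3) * real (b n) ^ (n + 1)) * \<theta>b n"
    using assms(2) \<theta>_pos(2)[of n] by (intro mult_right_mono) auto
  then show ?thesis using \<theta>b_bound[OF assms(1)] by simp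
qed

lemma b_le_bound: "1 \<le> n \<Longrightarrow> 1 + real (b n) \<le> real (n + 3) * real (b n) ^ (n + 1)"
proof -
  assume n: "1 \<le> n"
  have b: "1 \<le> real (b n)" using b_pos[OF n] by simp
  then have "real (b n) ^ 1 \<le> real (b n) ^ (n + 1)" by (intro power_increasing) auto
  then have "2 * real (b n) \<le> real (n + 3) * real (b n) ^ (n + 1)"
    using b by (intro mult_mono) auto
  then show ?thesis using b by linarith
qed

lemma E_free: "\<gamma> i = 0 \<Longrightarrow> E i = (1 / \<alpha> i) *\<^sub>R unit_vec i"
  by (subst E_rec) simp

lemma column_free: "\<gamma> j = 0 \<Longrightarrow> column j = \<alpha> j *\<^sub>R E (Suc j)"
  by (simp add: column_def)

lemma column_free_free:
  "\<gamma> j = 0 \<Longrightarrow> \<gamma> (Suc j) = 0 \<Longrightarrow> column j = (\<alpha> j / \<alpha> (Suc j)) *\<^sub>R unit_vec (Suc j)"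
  by (simp add: column_free E_free)

lemma E_0: "E 0 = unit_vec 0"
  using E_free[of 0] coeffs_0 by simp

lemma quotient_powr:
  assumes "1 \<le> n"
  shows "real n ^ i * 2 powr x / (real n ^ Suc i * 2 powr y) = 2 powr (x - y) / real n"
  using assms by (simp add: powr_diff)

lemma mult_powr_flip: "c * 2 powr (x / s) = c / 2 powr (- x / s)" for c x s :: real
  by (simp add: powr_minus_divide)

lemma divide_nat_le: "0 \<le> x \<Longrightarrow> 1 \<le> n \<Longrightarrow> x / real n \<le> x"
  using divide_left_mono[of 1 "real n" x] by simp

lemma powr_inverse_sqrt_le: "1 \<le> m \<Longrightarrow> 2 powr (1 / sqrt (real m)) \<le> 2"
  using powr_mono[of "1 / sqrt (real m)" 1 2] by (simp add: divide_le_eq_1)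

lemma block_B_start:
  assumes "1 \<le> n"
  shows "\<alpha> (Suc (v (n - 1))) = real n ^ Suc (v (n - 1)) / \<theta>a n" "\<gamma> (Suc (v (n - 1))) = 0"
proof -
  let ?i = "Suc (v (n - 1))"
  have *: "0 < n" "(if 0 = (0::nat) then v (n - 1) else 0 * a n + v (n - 0)) < ?i" "?i < (0 + 1) * a n"
    using a_large[OF assms] assms by auto
  show "\<gamma> ?i = 0" by (rule coeffs_B(6)[OF *])
  have eq: "(real 0 + 1/2) * real (a n) - real ?i = real (a n) / 2 - real (v (n - 1)) - 1" by simp
  show "\<alpha> ?i = real n ^ ?i / \<theta>a n"
    unfolding coeffs_B(5)[OF *] \<theta>a_def eq by (rule mult_powr_flip)
qed

lemma block_D_start:
  assumes "r < n"
  shows "\<alpha> (Suc (n * a n + r * b n)) = real n ^ Suc (n * a n + r * b n) / \<theta>b n"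
    "\<gamma> (Suc (n * a n + r * b n)) = 0"
proof -
  let ?i = "Suc (n * a n + r * b n)"
  have *: "r < n" "n * a n + r * b n < ?i" "?i < (r + 1) * (a n + b n)"
    using b_large[of n] assms by (auto simp: algebra_simps)
  show "\<gamma> ?i = 0" by (rule coeffs_D(4)[OF *])
  have eq: "(real r + 1/2) * real (b n) - real ?i = real (b n) / 2 - real (n * a n) - 1"
    by (simp add: algebra_simps)
  show "\<alpha> ?i = real n ^ ?i / \<theta>b n"
    unfolding coeffs_D(3)[OF *] \<theta>b_def eq by (rule mult_powr_flip)
qed

text \<open>
  Inside an interval of clause A the coefficients \<open>\<alpha>\<close> and \<open>\<gamma>\<close> both grow by the factor \<open>n - r\<close> from one
  index to the next while \<open>p\<close> moves along, so \<open>(n - r) T f\<^sub>j = f\<^bsub>j+1\<^esub>\<close> exactly.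
\<close>

lemma column_A_interior:
  assumes "1 \<le> r" "r < n" "s < v (n - r)"
  shows "column (r * a n + s) = (1 / real (n - r)) *\<^sub>R unit_vec (Suc (r * a n + s))"
proof -
  have s: "1 \<le> r" "r \<le> n" "s \<le> v (n - r)" "Suc s \<le> v (n - r)" using assms by auto
  note c = coeffs_A[OF s(1-3)] and c' = coeffs_A[OF s(1,2,4)]
  have "unit_vec (Suc (r * a n + s)) = real (n - r) *\<^sub>R column (r * a n + s)"
    using unit_vec_eq_E[of "r * a n + Suc s"]
    by (simp add: column_def c[simplified] c'[simplified] scaleR_right_diff_distrib mult_ac)
  then show ?thesis using assms by simp
qed

text \<open>
  With \<open>k = n - r\<close>, the index \<open>j = r a\<^sub>n + v\<^sub>k\<close> is the last one of its interval, so that \<open>j + 1\<close> and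
  \<open>p(j) + 1 = v\<^sub>k + 1\<close> are first indices of intervals in which \<open>e\<close> is a small multiple of \<open>f\<close>.  The second
  of them depends on \<open>k\<close> only.  Its entry is therefore small for large \<open>k\<close> but does not tend to \<open>0\<close>
  for fixed \<open>k\<close> and growing \<open>n\<close>: these entries form the compact, not small, part of the operator.
\<close>

lemma column_A_end:
  assumes "1 \<le> r" "r \<le> n"
  obtains g \<epsilon> where "column (r * a n + v (n - r)) = g - \<epsilon> *\<^sub>R unit_vec (Suc (v (n - r)))"
    "norm g \<le> 2 / real n" "0 \<le> \<epsilon>" "\<epsilon> \<le> 1 / real (n - r + 1)"
proof -
  define k where "k = n - r"
  define \<kappa> where "\<kappa> = real k ^ v k * real (a k)"
  let ?j = "r * a n + v k"
  have n: "1 \<le> n" using assms by simp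
  note c = coeffs_A[OF assms order_refl, folded k_def, folded \<kappa>_def]
  have \<kappa>_le: "\<kappa> \<le> real m ^ Suc (v k) * real (a k)" if "k < m" for m
  proof -
    have "real k ^ v k \<le> real m ^ v k" using that by (intro power_mono) auto
    also have "\<dots> \<le> real m ^ Suc (v k)" using that by (intro power_increasing) auto
    finally show ?thesis unfolding \<kappa>_def by (intro mult_right_mono) auto
  qed
  have \<kappa>0: "0 \<le> \<kappa>" by (simp add: \<kappa>_def)
  have "column ?j = \<alpha> ?j *\<^sub>R E (Suc ?j) - \<kappa> *\<^sub>R E (Suc (v k))"
    by (simp add: column_def c)
  also have "E (Suc (v k)) = (\<theta>a (Suc k) / real (Suc k) ^ Suc (v k)) *\<^sub>R unit_vec (Suc (v k))"
    using block_B_start[of "Suc k"] E_free[of "Suc (v k)"] by simp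
  finally have col: "column ?j = \<alpha> ?j *\<^sub>R E (Suc ?j)
      - (\<kappa> * \<theta>a (Suc k) / real (Suc k) ^ Suc (v k)) *\<^sub>R unit_vec (Suc (v k))"
    by simp
  have "\<kappa> * \<theta>a (Suc k) / real (Suc k) ^ Suc (v k) \<le> 1 / real (k + 1)"
  proof -
    have "\<kappa> * \<theta>a (Suc k) \<le> real (Suc k) ^ Suc (v k) * real (a k) * \<theta>a (Suc k)"
      using \<kappa>_le[of "Suc k"] \<theta>_pos(1)[of "Suc k"] by (intro mult_right_mono) auto
    then have "\<kappa> * \<theta>a (Suc k) / real (Suc k) ^ Suc (v k) \<le> real (a k) * \<theta>a (Suc k)"
      by (subst pos_divide_le_eq) (simp_all add: mult_ac del: power_Suc of_nat_Suc)
    also have "\<dots> \<le> 2 * real (a k) * \<theta>a (Suc k)" using \<theta>_pos(1)[of "Suc k"] by simp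
    also have "\<dots> \<le> 1 / real (k + 1)" using \<theta>a_bound[of k "Suc k"] by simp
    finally show ?thesis .
  qed
  moreover have "0 \<le> \<kappa> * \<theta>a (Suc k) / real (Suc k) ^ Suc (v k)"
    using \<kappa>0 \<theta>_pos(1)[of "Suc k"] by simp
  moreover have "norm (\<alpha> ?j *\<^sub>R E (Suc ?j)) \<le> 2 / real n"
  proof (cases "r = n")
    case True
    then have k: "k = 0" by (simp add: k_def)
    have "\<alpha> ?j = real n ^ (n * a n)"
      using c(5) True by (simp add: k v_0 \<kappa>_def a_0)
    moreover have "E (Suc ?j) = (\<theta>b n / real n ^ Suc (n * a n)) *\<^sub>R unit_vec (Suc ?j)"
      using block_D_start[of 0 n] E_free[of "Suc (n * a n)"] n True by (simp add: k v_0)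
    ultimately have "norm (\<alpha> ?j *\<^sub>R E (Suc ?j)) = \<theta>b n / real n"
      using n \<theta>_pos(2)[of n] by (simp add: norm_unit_vec)
    also have "\<dots> \<le> \<theta>b n" using n \<theta>_pos(2)[of n] by (intro divide_nat_le) auto
    also have "\<dots> \<le> 1 / real n" using \<theta>b_bound'[OF n, of 1] b_le_bound[OF n] by simp
    also have "\<dots> \<le> 2 / real n" by (simp add: divide_right_mono)
    finally show ?thesis .
  next
    case False
    then have r: "r < n" "k < n" using assms by (auto simp: k_def)
    have "v k + 2 \<le> a n" using v_diff_less_a[OF assms] by (simp add: k_def)
    then have B: "r < n" "(if r = 0 then v (n - 1) else r * a n + v (n - r)) < Suc ?j" "Suc ?j < (r + 1) * a n"
      using assms r by (auto simp: k_def)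
    let ?w = "2 powr (((real r + 1/2) * real (a n) - real (Suc ?j)) / sqrt (real (a n)))"
    \<comment> \<open>The exponent in \<open>\<theta>a n\<close> uses \<open>v\<^bsub>n-1\<^esub>\<close>, which is the largest of the possible \<open>v\<^sub>k\<close>.\<close>
    have w: "1 / ?w \<le> \<theta>a n"
    proof -
      have "v k \<le> v (n - 1)" using r assms by (intro v_mono) (auto simp: k_def)
      then have "- ((real r + 1/2) * real (a n) - real (Suc ?j))
          \<le> - (real (a n) / 2 - real (v (n - 1)) - 1)" by (simp add: algebra_simps)
      then have "- ((real r + 1/2) * real (a n) - real (Suc ?j)) / sqrt (real (a n))
          \<le> - (real (a n) / 2 - real (v (n - 1)) - 1) / sqrt (real (a n))"
        by (intro divide_right_mono) auto
      moreover have "1 / ?w = 2 powr (- ((real r + 1/2) * real (a n) - real (Suc ?j)) / sqrt (real (a n)))"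
        using mult_powr_flip[of 1 "- ((real r + 1/2) * real (a n) - real (Suc ?j))"] by simp
      ultimately show ?thesis
        unfolding \<theta>a_def by (simp only: powr_mono one_le_numeral)
    qed
    have "norm (\<alpha> ?j *\<^sub>R E (Suc ?j)) = \<alpha> ?j / \<alpha> (Suc ?j)"
      using E_free[OF coeffs_B(6)[OF B]] \<alpha>_pos[of ?j] \<alpha>_pos[of "Suc ?j"] by (simp add: norm_unit_vec)
    also have "\<dots> = \<kappa> / real n ^ Suc (v k) * (1 / ?w)"
      using n by (simp add: c coeffs_B(5)[OF B] power_add)
    also have "\<dots> \<le> real (a k) * \<theta>a n"
    proof (rule mult_mono)
      show "\<kappa> / real n ^ Suc (v k) \<le> real (a k)"
        using \<kappa>_le[OF r(2)] n by (subst pos_divide_le_eq) (auto simp: mult_ac)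
    qed (use w in auto)
    also have "\<dots> \<le> 2 * real (a k) * \<theta>a n" using \<theta>_pos(1)[of n] by simp
    also have "\<dots> \<le> 1 / real n" by (rule \<theta>a_bound[OF r(2)])
    also have "\<dots> \<le> 2 / real n" by (simp add: divide_right_mono)
    finally show ?thesis .
  qed
  ultimately show ?thesis using that col unfolding k_def by blast
qed

lemma column_B_interior:
  assumes B: "r < n" "(if r = 0 then v (n - 1) else r * a n + v (n - r)) < j" "Suc j < (r + 1) * a n"
  shows "column j = (2 powr (1 / sqrt (real (a n))) / real n) *\<^sub>R unit_vec (Suc j)"
proof -
  have B1: "r < n" "(if r = 0 then v (n - 1) else r * a n + v (n - r)) < j" "j < (r + 1) * a n"
    and B2: "r < n" "(if r = 0 then v (n - 1) else r * a n + v (n - r)) < Suc j" "Suc j < (r + 1) * a n"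
    using B by auto
  have "1 \<le> n" using B by simp
  from quotient_powr[OF this] show ?thesis
    unfolding column_free_free[OF coeffs_B(6)[OF B1] coeffs_B(6)[OF B2]] coeffs_B(5)[OF B1] coeffs_B(5)[OF B2]
    by (simp add: diff_divide_distrib[symmetric])
qed

text \<open>
  The next index \<open>r a\<^sub>n\<close> is the first one of an interval of clause A, where \<open>p = 0\<close>.  This is how
  \<open>T\<close> acquires positive entries in row \<open>0\<close>.
\<close>

lemma column_B_end:
  assumes "1 \<le> r" "r \<le> n"
  shows "column (r * a n - 1) = (\<alpha> (r * a n - 1) / real n ^ (r * a n)) *\<^sub>R
      ((1 / real (a (n - r))) *\<^sub>R unit_vec (r * a n) + unit_vec 0)"
    and "\<alpha> (r * a n - 1) / real n ^ (r * a n) \<le> \<theta>a n"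
proof -
  let ?j = "r * a n - 1"
  have n: "1 \<le> n" using assms by simp
  have ra: "1 \<le> r * a n" using a_pos[of n] assms by simp
  then have Suc: "Suc ?j = r * a n" by simp
  have B: "r - 1 < n" "(if r - 1 = 0 then v (n - 1) else (r - 1) * a n + v (n - (r - 1))) < ?j"
      "?j < (r - 1 + 1) * a n"
  proof -
    show "r - 1 < n" "?j < (r - 1 + 1) * a n" using assms ra by auto
    show "(if r - 1 = 0 then v (n - 1) else (r - 1) * a n + v (n - (r - 1))) < ?j"
    proof (cases "r = 1")
      case True
      then show ?thesis using a_large[OF n] by simp
    next
      case False
      then have "v (n - (r - 1)) + 2 \<le> a n" using assms by (intro v_diff_less_a) auto
      moreover have "r * a n = (r - 1) * a n + a n" using assms by (cases r) auto
      ultimately show ?thesis using False assms by simp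
    qed
  qed
  have A: "1 \<le> r" "r \<le> n" "0 \<le> v (n - r)" using assms by auto
  note c = coeffs_A[OF A, simplified]
  have "E (r * a n) = (1 / real n ^ (r * a n)) *\<^sub>R ((1 / real (a (n - r))) *\<^sub>R unit_vec (r * a n) + unit_vec 0)"
    using n a_pos[of "n - r"] by (subst E_rec) (simp add: c E_0 scaleR_add_right)
  then show "column ?j = (\<alpha> ?j / real n ^ (r * a n)) *\<^sub>R
      ((1 / real (a (n - r))) *\<^sub>R unit_vec (r * a n) + unit_vec 0)"
    unfolding column_free[OF coeffs_B(6)[OF B]] Suc by simp
  have r1: "real (r - 1) = real r - 1" using assms by simp
  have j: "real ?j = real r * real (a n) - 1" using ra by (simp add: of_nat_diff)
  have "\<alpha> ?j / real n ^ (r * a n) = 2 powr ((((real r - 1) + 1/2) * real (a n) - real ?j) / sqrt (real (a n))) / real n"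
  proof -
    have "real n ^ (r * a n) = real n * real n ^ ?j" by (subst Suc[symmetric]) (simp del: Suc_pred)
    then show ?thesis using n unfolding coeffs_B(5)[OF B] r1 by simp
  qed
  also have "\<dots> \<le> 2 powr ((((real r - 1) + 1/2) * real (a n) - real ?j) / sqrt (real (a n)))"
    using n by (intro divide_nat_le) auto
  also have "\<dots> \<le> \<theta>a n"
    unfolding \<theta>a_def j by (intro powr_mono divide_right_mono) (auto simp: algebra_simps)
  finally show "\<alpha> ?j / real n ^ (r * a n) \<le> \<theta>a n" .
qed

lemma norm_column_B_end:
  assumes "1 \<le> r" "r \<le> n"
  shows "norm (column (r * a n - 1)) \<le> 1 / real n"
proof -
  have "norm ((1 / real (a (n - r))) *\<^sub>R unit_vec (r * a n) + unit_vec 0) \<le> 1 / real (a (n - r)) + 1"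
    by (rule order_trans[OF norm_triangle_ineq]) (simp add: norm_unit_vec)
  also have "\<dots> \<le> 2" using a_pos[of "n - r"] by simp
  finally have "norm (column (r * a n - 1)) \<le> \<theta>a n * 2"
    unfolding column_B_end(1)[OF assms] norm_scaleR
    using column_B_end(2)[OF assms] \<alpha>_pos[of "r * a n - 1"] \<theta>_pos(1)[of n]
    by (intro mult_mono) auto
  then show ?thesis using \<theta>a_le[of n] assms by simp
qed

lemma column_C_interior:
  assumes "1 \<le> r" "r \<le> n" "r * (a n + b n) \<le> j" "j < n * a n + r * b n"
  shows "column j = (1 / real n) *\<^sub>R unit_vec (Suc j)"
proof -
  have C: "1 \<le> r" "r \<le> n" "r * (a n + b n) \<le> j" "j \<le> n * a n + r * b n"
    and C': "1 \<le> r" "r \<le> n" "r * (a n + b n) \<le> Suc j" "Suc j \<le> n * a n + r * b n" using assms by auto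
  note c = coeffs_C(3-6)[OF C] and c' = coeffs_C(3-6)[OF C']
  have "unit_vec (Suc j) = real n *\<^sub>R column j"
    unfolding unit_vec_eq_E[of "Suc j"] column_def c c' Suc_diff_le[OF c(1)]
    by (simp add: scaleR_right_diff_distrib mult_ac)
  then show ?thesis using assms by simp
qed

text \<open>
  Both \<open>j + 1\<close> and \<open>p(j) + 1 = j + 1 - b\<^sub>n\<close> are first indices of intervals of clause D, except that
  for \<open>r = n\<close> the index \<open>j + 1 = v\<^sub>n + 1\<close> starts the next level.
\<close>

lemma norm_column_C_end:
  assumes "1 \<le> r" "r \<le> n"
  shows "norm (column (n * a n + r * b n)) \<le> 2 / real n"
proof -
  let ?j = "n * a n + r * b n"
  have n: "1 \<le> n" using assms by simp
  have "r * (a n + b n) \<le> ?j" using assms by (simp add: distrib_left)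
  note c = coeffs_C(3-6)[OF assms this order_refl]
  have jb: "?j - b n = n * a n + (r - 1) * b n" using assms by (cases r) auto
  have r1: "r - 1 < n" using assms by simp
  have second: "norm (\<gamma> ?j *\<^sub>R E (Suc (pred_index ?j))) \<le> real (b n) * \<theta>b n"
  proof -
    have "norm (\<gamma> ?j *\<^sub>R E (Suc (pred_index ?j))) = real (b n) * \<theta>b n / real n"
      unfolding c jb using E_free[OF block_D_start(2)[OF r1]] block_D_start(1)[OF r1] n \<theta>_pos(2)[of n]
      by (simp add: norm_unit_vec)
    also have "\<dots> \<le> real (b n) * \<theta>b n"
      using n \<theta>_pos(2)[of n] by (intro divide_nat_le) auto
    finally show ?thesis .
  qed
  have b1: "real (b n) * \<theta>b n \<le> 1 / real n" "(1 + real (b n)) * \<theta>b n \<le> 1 / real n"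
    using \<theta>b_bound'[OF n, of "real (b n)"] \<theta>b_bound'[OF n, of "1 + real (b n)"] b_le_bound[OF n] by auto
  have first: "norm (\<alpha> ?j *\<^sub>R E (Suc ?j)) \<le> 1 / real n"
  proof (cases "r = n")
    case True
    then have v: "?j = v n" using v_eq[OF n] by simp
    then have \<alpha>v: "\<alpha> (v n) = real n ^ v n" using c(2) by simp
    have "norm (\<alpha> ?j *\<^sub>R E (Suc ?j)) = real n ^ v n / real (Suc n) ^ Suc (v n) * \<theta>a (Suc n)"
      unfolding v \<alpha>v using block_B_start[of "Suc n"] E_free[of "Suc (v n)"] \<theta>_pos(1)[of "Suc n"]
      by (simp add: norm_unit_vec del: power_Suc of_nat_Suc)
    also have "\<dots> \<le> 1 * \<theta>a (Suc n)"
    proof (rule mult_right_mono)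
      have "real n ^ v n \<le> real (Suc n) ^ v n" by (intro power_mono) auto
      also have "\<dots> \<le> real (Suc n) ^ Suc (v n)" by (intro power_increasing) auto
      finally show "real n ^ v n / real (Suc n) ^ Suc (v n) \<le> 1"
        by (subst pos_divide_le_eq) (auto simp del: power_Suc of_nat_Suc)
    qed (use \<theta>_pos(1)[of "Suc n"] in simp)
    also have "\<dots> \<le> 1 / real (Suc n)" using \<theta>a_le[of "Suc n"] \<theta>_pos(1)[of "Suc n"] by simp
    also have "\<dots> \<le> 1 / real n" using n by (intro divide_left_mono) auto
    finally show ?thesis .
  next
    case False
    then have r: "r < n" using assms by simp
    have "norm (\<alpha> ?j *\<^sub>R E (Suc ?j)) = \<theta>b n / real n"
      unfolding c using E_free[OF block_D_start(2)[OF r]] block_D_start(1)[OF r] n \<theta>_pos(2)[of n]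
      by (simp add: norm_unit_vec)
    also have "\<dots> \<le> \<theta>b n" using n \<theta>_pos(2)[of n] by (intro divide_nat_le) auto
    also have "\<dots> \<le> 1 / real n" using \<theta>b_bound'[OF n, of 1] b_le_bound[OF n] by simp
    finally show ?thesis .
  qed
  show ?thesis
    unfolding column_def
    using norm_triangle_ineq4[of "\<alpha> ?j *\<^sub>R E (Suc ?j)" "\<gamma> ?j *\<^sub>R E (Suc (pred_index ?j))"] first second b1
    by simp
qed

lemma column_D_interior:
  assumes D: "r < n" "n * a n + r * b n < j" "Suc j < (r + 1) * (a n + b n)"
  shows "column j = (2 powr (1 / sqrt (real (b n))) / real n) *\<^sub>R unit_vec (Suc j)"
proof -
  have D1: "r < n" "n * a n + r * b n < j" "j < (r + 1) * (a n + b n)"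
    and D2: "r < n" "n * a n + r * b n < Suc j" "Suc j < (r + 1) * (a n + b n)"
    using D by auto
  have "1 \<le> n" using D by simp
  from quotient_powr[OF this] show ?thesis
    unfolding column_free_free[OF coeffs_D(4)[OF D1] coeffs_D(4)[OF D2]] coeffs_D(3)[OF D1] coeffs_D(3)[OF D2]
    by (simp add: diff_divide_distrib[symmetric])
qed

text \<open>
  Unfolding clause C repeatedly moves down from \<open>s a\<^sub>n + r b\<^sub>n\<close> in steps of \<open>b\<^sub>n\<close> to \<open>s a\<^sub>n\<close>, an index of clause A;
  each step contributes a factor \<open>b\<^sub>n\<close> and one more unit vector.
\<close>

lemma norm_E_C_start:
  assumes "1 \<le> s" "s \<le> n" "r \<le> s"
  shows "real n ^ (s * a n + r * b n) * norm (E (s * a n + r * b n)) \<le> real (r + 2) * real (b n) ^ r"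
  using assms(3)
proof (induction r)
  case 0
  have n: "1 \<le> n" using assms by simp
  have A: "1 \<le> s" "s \<le> n" "0 \<le> v (n - s)" using assms by auto
  note c = coeffs_A[OF A, simplified]
  have "E (s * a n) = (1 / real n ^ (s * a n)) *\<^sub>R ((1 / real (a (n - s))) *\<^sub>R unit_vec (s * a n) + unit_vec 0)"
    using n a_pos[of "n - s"] by (subst E_rec) (simp add: c E_0 scaleR_add_right)
  then have "real n ^ (s * a n) * norm (E (s * a n))
      = norm ((1 / real (a (n - s))) *\<^sub>R unit_vec (s * a n) + unit_vec 0)"
    using n by simp
  also have "\<dots> \<le> 1 / real (a (n - s)) + 1"
    by (rule order_trans[OF norm_triangle_ineq]) (simp add: norm_unit_vec)
  also have "\<dots> \<le> 2" using a_pos[of "n - s"] by simp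
  finally show ?case by simp
next
  case (Suc r)
  let ?i = "s * a n + Suc r * b n"
  have n: "1 \<le> n" using assms by simp
  have "Suc r * a n \<le> s * a n" "s * a n \<le> n * a n" using Suc.prems assms by (intro mult_right_mono; simp)+
  then have C: "1 \<le> Suc r" "Suc r \<le> n" "Suc r * (a n + b n) \<le> ?i" "?i \<le> n * a n + Suc r * b n"
    using Suc.prems assms by (simp_all add: distrib_left)
  note c = coeffs_C(3-6)[OF C]
  have ib: "?i - b n = s * a n + r * b n" by simp
  have "real n ^ ?i * norm (E ?i) = norm (unit_vec ?i + (real (b n) * real n ^ (?i - b n)) *\<^sub>R E (?i - b n))"
    using n by (subst E_rec) (simp add: c(2-4) del: mult_Suc)
  also have "\<dots> \<le> 1 + real (b n) * (real n ^ (s * a n + r * b n) * norm (E (s * a n + r * b n)))"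
    unfolding ib by (rule order_trans[OF norm_triangle_ineq]) (simp add: norm_unit_vec mult_ac)
  also have "\<dots> \<le> 1 + real (b n) * (real (r + 2) * real (b n) ^ r)"
    using Suc by (intro add_left_mono mult_left_mono) auto
  also have "\<dots> \<le> real (b n) ^ Suc r + real (b n) * (real (r + 2) * real (b n) ^ r)"
    using b_pos[OF n] by (intro add_right_mono one_le_power) auto
  also have "\<dots> = real (Suc r + 2) * real (b n) ^ Suc r" by (simp add: algebra_simps)
  finally show ?case .
qed

lemma norm_column_D_end:
  assumes "1 \<le> r" "r \<le> n"
  shows "norm (column (r * (a n + b n) - 1)) \<le> 1 / real n"
proof -
  let ?j = "r * (a n + b n) - 1"
  have n: "1 \<le> n" using assms by simp
  have ra: "1 \<le> r * (a n + b n)" using a_pos[of n] assms by simp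
  then have Suc: "Suc ?j = r * (a n + b n)" by (intro Suc_diff_1) linarith
  have D: "r - 1 < n" "n * a n + (r - 1) * b n < ?j" "?j < (r - 1 + 1) * (a n + b n)"
  proof -
    show "r - 1 < n" using assms by simp
    have "r - 1 + 1 = r" using assms by simp
    then show "?j < (r - 1 + 1) * (a n + b n)" using Suc by (metis lessI)
    have "r * (a n + b n) = r * a n + (r - 1) * b n + b n" using assms by (cases r) (auto simp: algebra_simps)
    then show "n * a n + (r - 1) * b n < ?j" using b_large[OF n] assms a_pos[of n] by simp
  qed
  have r1: "real (r - 1) = real r - 1" using assms by simp
  have j: "real ?j = real r * (real (a n) + real (b n)) - 1" using ra by (simp add: of_nat_diff)
  have pow: "real n ^ (r * (a n + b n)) = real n * real n ^ ?j"
    by (subst Suc[symmetric]) (simp del: Suc_pred)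
  have "\<alpha> ?j = real n ^ (r * (a n + b n)) *
      (2 powr ((((real r - 1) + 1/2) * real (b n) - real ?j) / sqrt (real (b n))) / real n)"
    using n unfolding coeffs_D(3)[OF D] r1 pow by simp
  also have "\<dots> \<le> real n ^ (r * (a n + b n)) * \<theta>b n"
  proof (intro mult_left_mono)
    have "2 powr ((((real r - 1) + 1/2) * real (b n) - real ?j) / sqrt (real (b n))) / real n
        \<le> 2 powr ((((real r - 1) + 1/2) * real (b n) - real ?j) / sqrt (real (b n)))"
      using n by (intro divide_nat_le) auto
    also have "\<dots> \<le> \<theta>b n"
    proof -
      have "0 \<le> real r * real (a n)" by simp
      then have "((real r - 1) + 1/2) * real (b n) - real ?j \<le> - (real (b n) / 2 - real (n * a n) - 1)"
        unfolding j by (simp add: algebra_simps)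
      then show ?thesis unfolding \<theta>b_def by (intro powr_mono divide_right_mono) auto
    qed
    finally show "2 powr ((((real r - 1) + 1/2) * real (b n) - real ?j) / sqrt (real (b n))) / real n \<le> \<theta>b n" .
  qed simp
  finally have \<alpha>: "\<alpha> ?j \<le> real n ^ (r * (a n + b n)) * \<theta>b n" .
  have "norm (column ?j) = \<alpha> ?j * norm (E (r * (a n + b n)))"
    unfolding column_free[OF coeffs_D(4)[OF D]] Suc using \<alpha>_pos[of ?j] by simp
  also have "\<dots> \<le> real n ^ (r * (a n + b n)) * \<theta>b n * norm (E (r * (a n + b n)))"
    using \<alpha> by (intro mult_right_mono) auto
  also have "\<dots> = (real n ^ (r * a n + r * b n) * norm (E (r * a n + r * b n))) * \<theta>b n"
    by (simp add: distrib_left)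
  also have "\<dots> \<le> (real (r + 2) * real (b n) ^ r) * \<theta>b n"
    using norm_E_C_start[OF assms order_refl] \<theta>_pos(2)[of n] by (intro mult_right_mono) auto
  also have "\<dots> \<le> 1 / real n"
  proof (rule \<theta>b_bound'[OF n])
    have "real (b n) ^ r \<le> real (b n) ^ (n + 1)"
      using b_pos[OF n] assms by (intro power_increasing) auto
    then show "real (r + 2) * real (b n) ^ r \<le> real (n + 3) * real (b n) ^ (n + 1)"
      using assms by (intro mult_mono) auto
  qed
  finally show ?thesis .
qed

end

section \<open>Positive eigenvectors and invariant ideals of Read's operator\<close>

context rapid_read_sequence
begin

text \<open>
  The weights of the equivalent norm.  Only intervals of clause A with \<open>n - r < k\<close>, on which the shift
  does not contract enough, carry a weight other than \<open>1\<close>: it drops by the factor \<open>q\<close> at each step and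
  is still at least \<open>1\<close> at the end, since such an interval has at most \<open>v\<^sub>k + 1\<close> elements.
\<close>

definition weight :: "nat \<Rightarrow> real \<Rightarrow> nat \<Rightarrow> real" where
  "weight k q i =
    (let n = lev i; r = i div a n; s = i mod a n
     in if i \<le> n * a n \<and> 1 \<le> r \<and> s \<le> v (n - r) \<and> n - r < k then q ^ (v k - s) else 1)"

lemma weight_A:
  assumes "1 \<le> r" "r \<le> n" "s \<le> v (n - r)"
  shows "weight k q (r * a n + s) = (if n - r < k then q ^ (v k - s) else 1)"
  using assms unfolding weight_def Let_def coeffs_A(1)[OF assms] coeffs_A(2,3)[OF assms]
  using coeffs_A(4)[OF assms] by simp

lemma weight_B:
  assumes "r < n" "(if r = 0 then v (n - 1) else r * a n + v (n - r)) < i" "i < (r + 1) * a n"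
  shows "weight k q i = 1"
  using coeffs_B(4)[OF assms]
  unfolding weight_def Let_def coeffs_B(1)[OF assms] coeffs_B(2)[OF assms] by auto

lemma weight_C:
  assumes "1 \<le> r" "r \<le> n" "r * (a n + b n) \<le> i" "i \<le> n * a n + r * b n"
  shows "weight k q i = 1"
  using coeffs_C(2)[OF assms] unfolding weight_def Let_def coeffs_C(1)[OF assms] by simp

lemma weight_D:
  assumes "r < n" "n * a n + r * b n < i" "i < (r + 1) * (a n + b n)"
  shows "weight k q i = 1"
  using coeffs_D(2)[OF assms] unfolding weight_def Let_def coeffs_D(1)[OF assms] by simp

lemma weight_bounds:
  assumes "1 \<le> q"
  shows "1 \<le> weight k q i" "weight k q i \<le> q ^ v k"
  using assms by (auto simp: weight_def Let_def one_le_power intro!: power_increasing)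

text \<open>
  The three kinds of columns: exact shifts inside intervals of clause A, shifts with a
  weight that tends to \<open>0\<close>, and columns that tend to \<open>0\<close> in norm up to a multiple of a fixed
  sequence of unit vectors whose coefficients tend to \<open>0\<close>.
\<close>

lemma column_cases:
  assumes "0 < j"
  obtains (block) r n s where "1 \<le> r" "r < n" "s < v (n - r)" "j = r * a n + s"
      "column j = (1 / real (n - r)) *\<^sub>R unit_vec (Suc j)"
  | (shift) c where "0 \<le> c" "c \<le> 2 / real (lev j)" "column j = c *\<^sub>R unit_vec (Suc j)"
      "\<And>k q. weight k q (Suc j) = 1"
  | (small) g \<epsilon> k where "column j = g - \<epsilon> *\<^sub>R unit_vec (Suc (v k))"
      "norm g \<le> 2 / real (lev j)" "0 \<le> \<epsilon>" "\<epsilon> \<le> 1 / real (k + 1)"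
proof -
  have le2: "x / real n \<le> 2 / real n" if "x \<le> 2" for x n
    using that by (intro divide_right_mono) auto
  have smallI: thesis if "norm (column j) \<le> c / real (lev j)" "c \<le> 2" for c
    using small[of "column j" 0 0] that le2[of c "lev j"] by simp
  show thesis
  proof (cases j rule: index_cases)
    case zero
    then show thesis using assms by simp
  next
    case (A r n s)
    note lev = coeffs_A(1)[OF A(1-3), folded A(4)]
    show thesis
    proof (cases "s < v (n - r)")
      case True
      then have "r < n" using A(2) v_0 by (cases "r = n") auto
      then show thesis using block[OF A(1) _ True A(4)] column_A_interior[OF A(1) _ True] A(4) by simp
    next
      case False
      then have s: "s = v (n - r)" using A(3) by simp
      obtain g \<epsilon> where g: "column (r * a n + v (n - r)) = g - \<epsilon> *\<^sub>R unit_vec (Suc (v (n - r)))"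
          "norm g \<le> 2 / real n" "0 \<le> \<epsilon>" "\<epsilon> \<le> 1 / real (n - r + 1)"
        using column_A_end[OF A(1,2)] .
      show thesis by (rule small[of g \<epsilon> "n - r"]) (use g s A(4) lev in simp_all)
    qed
  next
    case (B r n)
    note lev = coeffs_B(1)[OF B]
    show thesis
    proof (cases "Suc j < (r + 1) * a n")
      case True
      have next_B: "r < n" "(if r = 0 then v (n - 1) else r * a n + v (n - r)) < Suc j" "Suc j < (r + 1) * a n"
        using B True by auto
      have "2 powr (1 / sqrt (real (a n))) \<le> 2"
        using a_pos[of n] by (intro powr_inverse_sqrt_le) simp
      then show thesis
        using shift[of "2 powr (1 / sqrt (real (a n))) / real n"] column_B_interior[OF B(1,2) True]
          weight_B[OF next_B] le2[of _ n] lev by simp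
    next
      case False
      then have "j = (r + 1) * a n - 1" using B(3) by simp
      then show thesis using norm_column_B_end[of "r + 1" n] B(1) lev smallI[of 1] by simp
    qed
  next
    case (C r n)
    note lev = coeffs_C(1)[OF C]
    show thesis
    proof (cases "j < n * a n + r * b n")
      case True
      have next_C: "1 \<le> r" "r \<le> n" "r * (a n + b n) \<le> Suc j" "Suc j \<le> n * a n + r * b n"
        using C True by auto
      show thesis
        using shift[of "1 / real n"] column_C_interior[OF C(1-3) True] weight_C[OF next_C] le2[of 1 n] lev
        by simp
    next
      case False
      then have "j = n * a n + r * b n" using C(4) by simp
      then show thesis using norm_column_C_end[OF C(1,2)] lev smallI[of 2] by simp
    qed
  next
    case (D r n)
    note lev = coeffs_D(1)[OF D]
    show thesis
    proof (cases "Suc j < (r + 1) * (a n + b n)")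
      case True
      have next_D: "r < n" "n * a n + r * b n < Suc j" "Suc j < (r + 1) * (a n + b n)"
        using D True by auto
      have "2 powr (1 / sqrt (real (b n))) \<le> 2"
        using b_pos[of n] D(1) by (intro powr_inverse_sqrt_le) simp
      then show thesis
        using shift[of "2 powr (1 / sqrt (real (b n))) / real n"] column_D_interior[OF D(1,2) True]
          weight_D[OF next_D] le2[of _ n] lev by simp
    next
      case False
      then have "j = (r + 1) * (a n + b n) - 1" using D(3) by simp
      then show thesis using norm_column_D_end[of "r + 1" n] D(1) lev smallI[of 1] by simp
    qed
  qed
qed

lemma column_0: "column 0 = E 1"
  by (simp add: column_def coeffs_0)

lemma norm_column_le: "norm (column j) \<le> 3"
proof (cases "j = 0")
  case True
  have "E 1 = \<theta>a 1 *\<^sub>R unit_vec 1"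
    using block_B_start[of 1] E_free[of 1] by (simp add: v_0)
  then show ?thesis using True \<theta>a_le[of 1] \<theta>_pos(1)[of 1] by (simp add: column_0 norm_unit_vec)
next
  case False
  then have j: "0 < j" by simp
  have lev: "2 / real (lev j) \<le> 2" using divide_nat_le[of 2 "lev j"] lev_bounds(1)[OF j] by simp
  from j show ?thesis
  proof (cases rule: column_cases)
    case (block r n s)
    have "1 / real (n - r) \<le> 1" using block(2) by simp
    then show ?thesis using block(5) by (simp add: norm_unit_vec)
  next
    case (shift c)
    then show ?thesis using lev by (simp add: norm_unit_vec)
  next
    case (small g \<epsilon> k)
    have "norm (column j) \<le> norm g + norm (\<epsilon> *\<^sub>R unit_vec (Suc (v k)))"
      unfolding small(1) by (rule norm_triangle_ineq4)
    also have "\<dots> \<le> 2 + 1"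
    proof (intro add_mono)
      have "\<epsilon> \<le> 1" by (rule order_trans[OF small(4)]) simp
      then show "norm (\<epsilon> *\<^sub>R unit_vec (Suc (v k))) \<le> 1"
        using small(3) by (simp add: norm_unit_vec)
    qed (use small(2) lev in simp)
    finally show ?thesis by simp
  qed
qed

lemma entry_read_operator: "entry (read_operator d) i j = coord (column j) i"
  using read_operator_columns[OF norm_column_le] by (simp add: entry_def)

lemma sum_coord_le_norm: "(\<Sum>i=R..<M. \<bar>coord x i\<bar>) \<le> norm x"
  by (rule sum_le_norm_ell1) simp

text \<open>
  The cut-off \<open>R\<close> is some \<open>a\<^sub>N\<close>.  Columns before it have no entries beyond it except column \<open>a\<^sub>N - 1\<close>,
  which is small.  Columns after it have level at least \<open>N\<close>, and the entries in row \<open>v\<^sub>k + 1\<close> count only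
  if \<open>v\<^sub>k + 1 \<ge> a\<^sub>N\<close>, that is \<open>k \<ge> N\<close>, when they are small too.
\<close>

lemma tail_estimate:
  assumes \<delta>: "0 < \<delta>"
  obtains u U where "\<And>i. 1 \<le> u i" "\<And>i. u i \<le> (U::real)"
    "\<And>\<epsilon>. \<epsilon> > 0 \<Longrightarrow> \<exists>R. (\<forall>j\<ge>R. \<forall>M. (\<Sum>i=R..<M. u i * \<bar>coord (column j) i\<bar>) \<le> \<delta> / 2 * u j) \<and>
                    (\<forall>j<R. \<forall>M. (\<Sum>i=R..<M. u i * \<bar>coord (column j) i\<bar>) \<le> \<epsilon>)"
proof -
  \<comment> \<open>With \<open>\<delta> / 2 * q \<ge> 1\<close>, a drop of the weight by \<open>q\<close> makes up for any shift weight up to \<open>1\<close>.\<close>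
  define q where "q = max 1 (2 / \<delta>)"
  have q: "1 \<le> q" "1 \<le> \<delta> / 2 * q" using \<delta> by (auto simp: q_def max_def field_simps)
  \<comment> \<open>From \<open>k\<close> on, the shift weight \<open>1/k\<close> is at most \<open>\<delta> / 2\<close>, and no correction is needed.\<close>
  obtain k where k: "2 / \<delta> < real k" using reals_Archimedean2 by blast
  have k\<delta>: "1 / real m \<le> \<delta> / 2" if "k \<le> m" for m
  proof -
    have "2 / \<delta> < real m" using k that by (simp add: less_le_trans)
    moreover have "0 < 2 / \<delta>" using \<delta> by simp
    ultimately have "inverse (real m) \<le> inverse (2 / \<delta>)"
      by (intro le_imp_inverse_le) auto
    then show ?thesis by (simp add: inverse_eq_divide)
  qed
  define u where "u = weight k q"
  define U where "U = q ^ v k"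
  have u: "1 \<le> u i" "u i \<le> U" for i using weight_bounds[OF q(1)] by (simp_all add: u_def U_def)
  have U: "1 \<le> U" using u[of 0] by linarith
  have single: "(\<Sum>i=R..<M. u i * \<bar>coord (c *\<^sub>R unit_vec l) i\<bar>) \<le> (if R \<le> l then u l * \<bar>c\<bar> else 0)" for R M l c
  proof -
    have "(\<Sum>i=R..<M. u i * \<bar>coord (c *\<^sub>R unit_vec l) i\<bar>) = (\<Sum>i=R..<M. if i = l then u l * \<bar>c\<bar> else 0)"
      by (intro sum.cong) (auto simp: coord_unit_vec)
    also have "\<dots> \<le> (if R \<le> l then u l * \<bar>c\<bar> else 0)"
      using u(1)[of l] by (subst sum.delta) auto
    finally show ?thesis .
  qed
  have crude: "(\<Sum>i=R..<M. u i * \<bar>coord x i\<bar>) \<le> U * norm x" for R M x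
  proof -
    have "(\<Sum>i=R..<M. u i * \<bar>coord x i\<bar>) \<le> (\<Sum>i=R..<M. U * \<bar>coord x i\<bar>)"
      by (intro sum_mono mult_right_mono u) auto
    also have "\<dots> \<le> U * norm x"
      unfolding sum_distrib_left[symmetric] using U sum_coord_le_norm by (intro mult_left_mono) auto
    finally show ?thesis .
  qed
  have main: "\<exists>R. (\<forall>j\<ge>R. \<forall>M. (\<Sum>i=R..<M. u i * \<bar>coord (column j) i\<bar>) \<le> \<delta> / 2 * u j) \<and>
                    (\<forall>j<R. \<forall>M. (\<Sum>i=R..<M. u i * \<bar>coord (column j) i\<bar>) \<le> \<epsilon>)" if \<epsilon>: "\<epsilon> > 0" for \<epsilon>
  proof -
    \<comment> \<open>In the weighted norm, at most \<open>2 * U / N\<close> comes from the vector \<open>g\<close> of a small column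
      and \<open>U / N\<close> from its entry in row \<open>v\<^sub>k + 1\<close>; column \<open>a\<^sub>N - 1\<close> contributes at most \<open>U / N\<close>.\<close>
    obtain N0 where N0: "max (6 * U / \<delta>) (U / \<epsilon>) < real N0" using reals_Archimedean2 by blast
    define N where "N = max 1 N0"
    have N: "1 \<le> N" "6 * U / \<delta> < real N" "U / \<epsilon> < real N" using N0 by (auto simp: N_def)
    have N\<delta>: "3 * U / real N \<le> \<delta> / 2" using N \<delta> by (simp add: field_simps)
    have N\<epsilon>: "U / real N \<le> \<epsilon>" using N \<epsilon> by (simp add: field_simps)
    have "(\<Sum>i=a N..<M. u i * \<bar>coord (column j) i\<bar>) \<le> \<delta> / 2 * u j" if j: "a N \<le> j" for j M
    proof -
      have j0: "0 < j" using j a_pos[of N] by simp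
      have levN: "N \<le> lev j"
      proof (rule ccontr)
        assume "\<not> N \<le> lev j"
        then have "v (lev j) \<le> v (N - 1)" by (intro v_mono) simp
        then show False using lev_bounds(3)[OF j0] v_less_a[OF N(1)] j by simp
      qed
      have lev: "2 / real (lev j) \<le> 2 / real N"
        using levN N(1) by (intro divide_left_mono) auto
      have N2: "2 * U / real N + U / real N \<le> \<delta> / 2" using N\<delta> by (simp add: add_divide_distrib[symmetric])
      have UN: "2 / real N \<le> 2 * U / real N" "0 \<le> U / real N" using U by (auto intro!: divide_right_mono)
      have one: "\<delta> / 2 \<le> \<delta> / 2 * u j" using u(1)[of j] \<delta> by simp
      from j0 show ?thesis
      proof (cases rule: column_cases)
        case (block r n s)
        have s: "1 \<le> r" "r \<le> n" "s \<le> v (n - r)" "Suc s \<le> v (n - r)" using block by auto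
        have w: "u j = (if n - r < k then q ^ (v k - s) else 1)"
            "u (Suc j) = (if n - r < k then q ^ (v k - Suc s) else 1)"
          using weight_A[OF s(1-3), of k q] weight_A[OF s(1,2,4), of k q] block(4) by (simp_all add: u_def)
        have "(\<Sum>i=a N..<M. u i * \<bar>coord (column j) i\<bar>) \<le> u (Suc j) * (1 / real (n - r))"
          unfolding block(5) using j by (intro order_trans[OF single]) simp
        also have "\<dots> \<le> \<delta> / 2 * u j"
        proof (cases "n - r < k")
          case True
          then have "v (n - r) \<le> v k" by (intro v_mono) simp
          then have "v k - s = Suc (v k - Suc s)" using s(4) by simp
          then have uj: "u j = q * u (Suc j)" using w True by simp
          have "u (Suc j) * (1 / real (n - r)) \<le> u (Suc j) * 1"
            using u(1)[of "Suc j"] block(2) by (intro mult_left_mono) auto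
          also have "\<dots> \<le> u (Suc j) * (\<delta> / 2 * q)"
            using u(1)[of "Suc j"] q(2) by (intro mult_left_mono) auto
          finally show ?thesis unfolding uj by (simp add: mult_ac)
        next
          case False
          then show ?thesis using w k\<delta>[of "n - r"] by simp
        qed
        finally show ?thesis .
      next
        case (shift c)
        have "(\<Sum>i=a N..<M. u i * \<bar>coord (column j) i\<bar>) \<le> c"
          unfolding shift(3) using j shift(1,4) by (intro order_trans[OF single]) (simp add: u_def)
        also have "\<dots> \<le> \<delta> / 2" using shift(2) lev UN N2 by linarith
        finally show ?thesis using one by simp
      next
        case (small g \<epsilon>' l)
        have "(\<Sum>i=a N..<M. u i * \<bar>coord (column j) i\<bar>)
            \<le> (\<Sum>i=a N..<M. u i * \<bar>coord g i\<bar> + u i * \<bar>coord (\<epsilon>' *\<^sub>R unit_vec (Suc (v l))) i\<bar>)"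
        proof (rule sum_mono)
          fix i
          have "\<bar>coord (column j) i\<bar> \<le> \<bar>coord g i\<bar> + \<bar>coord (\<epsilon>' *\<^sub>R unit_vec (Suc (v l))) i\<bar>"
            unfolding small(1) coord_simps by (rule abs_triangle_ineq4)
          then show "u i * \<bar>coord (column j) i\<bar>
              \<le> u i * \<bar>coord g i\<bar> + u i * \<bar>coord (\<epsilon>' *\<^sub>R unit_vec (Suc (v l))) i\<bar>"
            using u(1)[of i] by (simp add: distrib_left[symmetric] mult_left_mono del: coord_simps)
        qed
        also have "\<dots> \<le> U * norm g + (if a N \<le> Suc (v l) then u (Suc (v l)) * \<bar>\<epsilon>'\<bar> else 0)"
          unfolding sum.distrib by (intro add_mono crude single)
        also have "U * norm g \<le> 2 * U / real N"
        proof -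
          have "U * norm g \<le> U * (2 / real N)"
            using small(2) lev U by (intro mult_left_mono) auto
          then show ?thesis by (simp add: mult_ac)
        qed
        also have "(if a N \<le> Suc (v l) then u (Suc (v l)) * \<bar>\<epsilon>'\<bar> else 0) \<le> U / real N"
        proof (cases "a N \<le> Suc (v l)")
          case True
          have "N \<le> l"
          proof (rule ccontr)
            assume "\<not> N \<le> l"
            then have "v l \<le> v (N - 1)" by (intro v_mono) simp
            then show False using a_large[OF N(1)] True by simp
          qed
          then have "1 / real (l + 1) \<le> 1 / real N" using N(1) by (intro divide_left_mono) auto
          then have "u (Suc (v l)) * \<bar>\<epsilon>'\<bar> \<le> U * (1 / real N)"
            using small(3,4) u U by (intro mult_mono) auto
          then show ?thesis using True by simp
        qed (use UN in simp)
        finally show ?thesis using one N2 by linarith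
      qed
    qed
    moreover have "(\<Sum>i=a N..<M. u i * \<bar>coord (column j) i\<bar>) \<le> \<epsilon>" if j: "j < a N" for j M
    proof (cases "Suc j = a N")
      case True
      then have jN: "j = 1 * a N - 1" by simp
      have "norm (column j) \<le> 1 / real N"
        unfolding jN by (rule norm_column_B_end) (use N(1) in auto)
      then have "U * norm (column j) \<le> U * (1 / real N)" using U by (intro mult_left_mono) auto
      then show ?thesis using crude[where x = "column j" and R = "a N" and M = M] N\<epsilon> by simp
    next
      case False
      then have "(\<Sum>i=a N..<M. u i * \<bar>coord (column j) i\<bar>) = 0"
        using j column_support[of j] by (intro sum.neutral) auto
      then show ?thesis using \<epsilon> by simp
    qed
    ultimately show ?thesis by blast
  qed
  show ?thesis by (rule that[OF u main])
qed

lemma column_B_end_coord_0: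
  assumes "1 \<le> n"
  shows "0 < coord (column (n * a n - 1)) 0"
proof -
  have "n * a n \<noteq> 0" using a_pos[of n] assms by simp
  then show ?thesis
    unfolding column_B_end(1)[OF assms order_refl]
    using \<alpha>_pos[of "n * a n - 1"] assms by (simp add: coord_unit_vec)
qed

lemma column_subdiagonal_pos: "0 < coord (column j) (Suc j)"
  using \<alpha>_pos[of j] \<alpha>_pos[of "Suc j"] by (simp add: column_subdiagonal)

text \<open>
  The row sums over \<open>0, \<dots>, a\<^sub>1 - 1\<close> are positive since row \<open>0\<close> has a positive entry in column \<open>a\<^sub>1 - 1\<close>
  and every other row has one on the subdiagonal; their minimum is the \<open>\<delta>\<close> required by
  \<open>positive_eigenvectorI\<close>.
\<close>

lemma positive_eigenvector_of_dominated:
  fixes S :: ell1_op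
  assumes nonneg: "\<And>i j. 0 \<le> entry S i j"
    and le: "\<And>i j. entry S i j \<le> \<bar>coord (column j) i\<bar>"
    and pos: "\<And>i j. 0 < coord (column j) i \<Longrightarrow> 0 < entry S i j"
  shows "has_positive_eigenvector S"
proof -
  define p where "p = a 1 - 1"
  define \<delta> where "\<delta> = Min ((\<lambda>i. \<Sum>j\<le>p. entry S i j) ` {..p})"
  have row: "0 < (\<Sum>j\<le>p. entry S i j)" if i: "i \<le> p" for i
  proof (cases i)
    case 0
    have "0 < entry S 0 p" using pos column_B_end_coord_0[of 1] by (simp add: p_def)
    then show ?thesis using 0 nonneg by (intro sum_pos2[where i = p]) auto
  next
    case (Suc l)
    have "0 < entry S i l" using pos column_subdiagonal_pos[of l] Suc by simp
    then show ?thesis using Suc i nonneg by (intro sum_pos2[where i = l]) auto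
  qed
  have \<delta>: "0 < \<delta>" unfolding \<delta>_def using row by (subst Min_gr_iff) auto
  have \<delta>_le: "\<delta> \<le> (\<Sum>j\<le>p. entry S i j)" if "i \<le> p" for i
    unfolding \<delta>_def using that by (intro Min_le) auto
  obtain u U where u: "\<And>i. 1 \<le> u i" "\<And>i. u i \<le> (U::real)"
    and tail: "\<And>\<epsilon>. \<epsilon> > 0 \<Longrightarrow> \<exists>R. (\<forall>j\<ge>R. \<forall>M. (\<Sum>i=R..<M. u i * \<bar>coord (column j) i\<bar>) \<le> \<delta> / 2 * u j) \<and>
                    (\<forall>j<R. \<forall>M. (\<Sum>i=R..<M. u i * \<bar>coord (column j) i\<bar>) \<le> \<epsilon>)"
    by (rule tail_estimate[OF \<delta>]) (rule that; assumption)
  have dom: "(\<Sum>i=R..<M. u i * entry S i j) \<le> (\<Sum>i=R..<M. u i * \<bar>coord (column j) i\<bar>)" for R M j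
    using u(1) by (intro sum_mono mult_left_mono le) (auto intro: order_trans[OF zero_le_one])
  show ?thesis
  proof (rule positive_eigenvectorI[OF nonneg u \<delta> \<delta>_le])
    fix \<epsilon> :: real assume "\<epsilon> > 0"
    then show "\<exists>R. (\<forall>j\<ge>R. \<forall>M. (\<Sum>i=R..<M. u i * entry S i j) \<le> \<delta> / 2 * u j) \<and>
                    (\<forall>j<R. \<forall>M. (\<Sum>i=R..<M. u i * entry S i j) \<le> \<epsilon>)"
      using tail dom order_trans by meson
  qed
qed

lemma no_invariant_ideal_of_dominating:
  fixes S :: ell1_op
  assumes pos: "\<And>i j. 0 < coord (column j) i \<Longrightarrow> 0 < entry S i j"
  shows "\<not> has_invariant_ideal S"
proof (rule no_invariant_ideal)
  show "entry S (Suc j) j \<noteq> 0" for j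
    using pos[OF column_subdiagonal_pos, of j] by simp
  show "\<exists>m\<ge>j. entry S 0 m \<noteq> 0" for j
  proof -
    \<comment> \<open>Any level above \<open>j\<close> will do.\<close>
    let ?n = "Suc j"
    have "?n \<le> a ?n - 1"
    proof -
      have "j \<le> v j" using strict_mono_v by (rule strict_mono_imp_increasing)
      then show ?thesis using a_large[of ?n] by simp
    qed
    then have "j \<le> ?n * a ?n - 1" using a_le_na[of ?n] by simp
    moreover have "entry S 0 (?n * a ?n - 1) \<noteq> 0"
      using pos[OF column_B_end_coord_0, of ?n] by simp
    ultimately show ?thesis by blast
  qed
qed

theorem read_operator_properties:
  "(has_positive_eigenvector (op_abs (read_operator d)) \<and>
    has_positive_eigenvector (op_pos (read_operator d)) \<and>
    has_positive_eigenvector (op_neg (read_operator d))) \<and>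
   (\<not> has_invariant_ideal (op_abs (read_operator d)) \<and>
    \<not> has_invariant_ideal (op_pos (read_operator d)))"
proof (intro conjI)
  show "has_positive_eigenvector (op_abs (read_operator d))"
    "has_positive_eigenvector (op_pos (read_operator d))"
    by (rule positive_eigenvector_of_dominated; simp add: entry_op_abs entry_op_pos entry_read_operator)+
  show "\<not> has_invariant_ideal (op_abs (read_operator d))"
    "\<not> has_invariant_ideal (op_pos (read_operator d))"
    by (rule no_invariant_ideal_of_dominating; simp add: entry_op_abs entry_op_pos entry_read_operator)+
  \<comment> \<open>The column \<open>T f\<^sub>0 = e\<^sub>1\<close> is nonnegative, so the negative part annihilates \<open>f\<^sub>0\<close>.\<close>
  have "op_neg (read_operator d) (unit_vec 0) = 0"
  proof (rule ell1_eqI)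
    fix i
    have "coord (op_neg (read_operator d) (unit_vec 0)) i = entry (op_neg (read_operator d)) i 0"
      by (simp add: entry_def)
    also have "\<dots> = 0"
      using E_nonneg[of 1 i] by (simp add: entry_op_neg entry_read_operator column_0)
    finally show "coord (op_neg (read_operator d) (unit_vec 0)) i = coord 0 i" by simp
  qed
  moreover have "0 \<le> unit_vec 0" by (simp add: less_eq_ell1_def coord_unit_vec)
  ultimately show "has_positive_eigenvector (op_neg (read_operator d))"
    unfolding has_positive_eigenvector_def using unit_vec_neq_0
    by (intro exI[of _ "unit_vec 0"] exI[of _ 0]) simp
qed

end

section \<open>Sequences that increase sufficiently rapidly\<close>

text \<open>
  One growth condition that serves for both \<open>a\<^sub>n\<close> and \<open>b\<^sub>n\<close>: it holds for large \<open>m\<close>, and \<open>z\<close> stands for any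
  common upper bound of the quantities that are already fixed.
\<close>

definition rapid_bound :: "nat \<Rightarrow> nat \<Rightarrow> nat \<Rightarrow> bool" where
  "rapid_bound n z m \<longleftrightarrow> z + 2 \<le> m \<and>
     real (n + 3) * real z * real m ^ (n + 1) * 2 powr (- (real m / 2 - real z - 1) / sqrt (real m)) \<le> 1 / real n"

lemma eventually_rapid_bound:
  assumes "1 \<le> n"
  shows "\<exists>g>0. \<forall>m\<ge>g. rapid_bound n z m"
proof -
  have "(\<lambda>m. real (n + 3) * real z * real m ^ (n + 1) *
      2 powr (- (real m / 2 - real z - 1) / sqrt (real m))) \<longlonglongrightarrow> 0"
    by real_asymp
  then have "\<forall>\<^sub>F m in sequentially. real (n + 3) * real z * real m ^ (n + 1) *
      2 powr (- (real m / 2 - real z - 1) / sqrt (real m)) < 1 / real n"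
    by (rule order_tendstoD(2)) (use assms in simp)
  then have "\<forall>\<^sub>F m in sequentially. rapid_bound n z m"
    using eventually_ge_at_top[of "z + 2"]
    by eventually_elim (simp add: rapid_bound_def less_imp_le)
  then obtain g where "\<forall>m\<ge>g. rapid_bound n z m" unfolding eventually_sequentially by blast
  then show ?thesis by (intro exI[of _ "Suc g"]) auto
qed

text \<open>
  The bound \<open>z = n * sum_list xs\<close> dominates \<open>a\<^bsub>n-1\<^esub>\<close> and \<open>v\<^bsub>n-1\<^esub>\<close> when \<open>xs\<close> ends with \<open>b\<^bsub>n-1\<^esub>\<close>, and
  \<open>n a\<^sub>n\<close> when \<open>xs\<close> ends with \<open>a\<^sub>n\<close>.\<close>

definition rapid_growth :: "nat \<Rightarrow> nat list \<Rightarrow> nat" where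
  "rapid_growth n xs = (SOME g. 0 < g \<and> (1 \<le> n \<longrightarrow> (\<forall>m\<ge>g. rapid_bound n (n * sum_list xs) m)))"

lemma rapid_growth:
  shows "0 < rapid_growth n xs"
    and "1 \<le> n \<Longrightarrow> rapid_growth n xs \<le> m \<Longrightarrow> rapid_bound n (n * sum_list xs) m"
proof -
  have "\<exists>g. 0 < g \<and> (1 \<le> n \<longrightarrow> (\<forall>m\<ge>g. rapid_bound n (n * sum_list xs) m))"
    using eventually_rapid_bound[of n] by (cases "1 \<le> n") auto
  from someI_ex[OF this, folded rapid_growth_def]
  show "0 < rapid_growth n xs"
    and "1 \<le> n \<Longrightarrow> rapid_growth n xs \<le> m \<Longrightarrow> rapid_bound n (n * sum_list xs) m" by blast+
qed

lemma rapid_boundD: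
  assumes "rapid_bound n z m" "x \<le> z" "0 \<le> c" "c \<le> real (n + 3) * real z * real m ^ (n + 1)"
  shows "x + 2 \<le> m" "c * 2 powr (- (real m / 2 - real x - 1) / sqrt (real m)) \<le> 1 / real n"
proof -
  show "x + 2 \<le> m" using assms(1,2) by (simp add: rapid_bound_def)
  have "2 powr (- (real m / 2 - real x - 1) / sqrt (real m))
      \<le> 2 powr (- (real m / 2 - real z - 1) / sqrt (real m))"
    using assms(2) by (intro powr_mono divide_right_mono) auto
  then have "c * 2 powr (- (real m / 2 - real x - 1) / sqrt (real m))
      \<le> (real (n + 3) * real z * real m ^ (n + 1)) * 2 powr (- (real m / 2 - real z - 1) / sqrt (real m))"
    using assms(3,4) by (intro mult_mono) auto
  also have "\<dots> \<le> 1 / real n" using assms(1) by (simp add: rapid_bound_def)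
  finally show "c * 2 powr (- (real m / 2 - real x - 1) / sqrt (real m)) \<le> 1 / real n" .
qed

lemma rapid_read_sequenceI:
  assumes "increases_at_least rapid_growth rapid_growth d"
  shows "rapid_read_sequence d"
proof -
  have A: "seq_v d (n - 1) + 2 \<le> seq_a d n"
      "2 * real (seq_a d (n - 1)) *
        2 powr (- (real (seq_a d n) / 2 - real (seq_v d (n - 1)) - 1) / sqrt (real (seq_a d n))) \<le> 1 / real n"
    if n: "1 \<le> n" for n
  proof -
    define xs where "xs = seq_a d 0 # map d [0..<2 * n - 2]"
    define z where "z = n * sum_list xs"
    have bound: "rapid_bound n z (seq_a d n)"
      using assms n rapid_growth(2)[OF n] unfolding increases_at_least_def z_def xs_def by blast
    have az: "seq_a d (n - 1) \<le> sum_list xs" and vz: "seq_v d (n - 1) \<le> z"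
    proof -
      show "seq_a d (n - 1) \<le> sum_list xs"
      proof (cases "n = 1")
        case False
        then obtain m where m: "n = m + 2" 
          using n by (intro that[of "n - 2"]) simp
        show ?thesis by (simp add: xs_def m seq_a_def)
      qed (simp add: xs_def)
      show "seq_v d (n - 1) \<le> z"
      proof (cases "n = 1")
        case False
        then obtain m where m: "n = m + 2" 
          using n by (intro that[of "n - 2"]) simp
        have "seq_a d (n - 1) + seq_b d (n - 1) \<le> sum_list xs"
          by (simp add: xs_def m seq_a_def seq_b_def)
        then have "(n - 1) * (seq_a d (n - 1) + seq_b d (n - 1)) \<le> z"
          unfolding z_def by (intro mult_mono) auto
        then show ?thesis using False n by (simp add: seq_v_def)
      qed (simp add: seq_v_def)
    qed
    have "1 \<le> sum_list xs" by (simp add: xs_def seq_a_def)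
    have m1: "1 \<le> seq_a d n" using bound by (simp add: rapid_bound_def)
    have "sum_list xs \<le> z" using n by (simp add: z_def)
    then have "real (seq_a d (n - 1)) \<le> real z" using az by linarith
    moreover have "1 \<le> real (seq_a d n) ^ (n + 1)" using m1 by (intro one_le_power) simp
    ultimately have "2 * real (seq_a d (n - 1)) * 1 \<le> real (n + 3) * real z * real (seq_a d n) ^ (n + 1)"
      by (intro mult_mono) auto
    then have "2 * real (seq_a d (n - 1)) \<le> real (n + 3) * real z * real (seq_a d n) ^ (n + 1)" by simp
    from rapid_boundD[OF bound vz _ this]
    show "seq_v d (n - 1) + 2 \<le> seq_a d n"
      "2 * real (seq_a d (n - 1)) *
        2 powr (- (real (seq_a d n) / 2 - real (seq_v d (n - 1)) - 1) / sqrt (real (seq_a d n))) \<le> 1 / real n"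
      by simp_all
  qed
  have B: "n * seq_a d n + 2 \<le> seq_b d n"
      "real (n + 3) * real (seq_b d n) ^ (n + 1) *
        2 powr (- (real (seq_b d n) / 2 - real (n * seq_a d n) - 1) / sqrt (real (seq_b d n))) \<le> 1 / real n"
    if n: "1 \<le> n" for n
  proof -
    define xs where "xs = seq_a d 0 # map d [0..<2 * n - 1]"
    define z where "z = n * sum_list xs"
    have bound: "rapid_bound n z (seq_b d n)"
      using assms n rapid_growth(2)[OF n] unfolding increases_at_least_def z_def xs_def by blast
    obtain m where m: "n = Suc m" using n by (cases n) auto
    have s: "seq_a d n + 1 \<le> sum_list xs" by (simp add: xs_def m seq_a_def)
    have az: "n * seq_a d n \<le> z" using s unfolding z_def by (intro mult_left_mono) auto
    have "1 \<le> z" using s n unfolding z_def by (simp add: Suc_leI)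
    then have "real (n + 3) * 1 * real (seq_b d n) ^ (n + 1) \<le> real (n + 3) * real z * real (seq_b d n) ^ (n + 1)"
      by (intro mult_mono) auto
    then have "real (n + 3) * real (seq_b d n) ^ (n + 1) \<le> real (n + 3) * real z * real (seq_b d n) ^ (n + 1)" by simp
    from rapid_boundD[OF bound az _ this]
    show "n * seq_a d n + 2 \<le> seq_b d n"
      "real (n + 3) * real (seq_b d n) ^ (n + 1) *
        2 powr (- (real (seq_b d n) / 2 - real (n * seq_a d n) - 1) / sqrt (real (seq_b d n))) \<le> 1 / real n"
      by simp_all
  qed
  show ?thesis by unfold_locales (fact A B)+
qed

theorem corollary7:
  shows "provided_rapidly_increasing (\<lambda>d.
    (has_positive_eigenvector (op_abs (read_operator d)) \<and>
     has_positive_eigenvector (op_pos (read_operator d)) \<and>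
     has_positive_eigenvector (op_neg (read_operator d))) \<and>
    (\<not> has_invariant_ideal (op_abs (read_operator d)) \<and>
     \<not> has_invariant_ideal (op_pos (read_operator d))))"
  unfolding provided_rapidly_increasing_def
  using rapid_growth(1) rapid_read_sequence.read_operator_properties[OF rapid_read_sequenceI]
  by (intro exI[of _ rapid_growth] conjI allI impI) blast+

end
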